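(* Let $A=(A_0,A_1,A_2,A_3)$ be generic complex parameters. The normalized local solution $f^{(\infty,+A_2)}(A;x)$ of $Z(A)$ at $x=\infty$ with exponent $1-A_0+A_2$ is given by each of the following expressions: \begin{align*} f^{(\infty,+A_2)}(A;x) &=\Big(\frac1x\Big)^{1-A_0+A_2}\sum_{n=0}^\infty\Big(\frac1x\Big)^n\frac{(\frac12+A_2)_n(A_{--+-})_n(A_{+-++})_n}{n!\,(1+A_2-A_3)_n(1+A_2+A_3)_n}\\ &\qquad\times{}_4F_3\!\left(\begin{matrix} -n,\ -A_2-n,\ A_{-+++},\ A_{+++-} \\ A_{-+--}-n,\ A_{++-+}-n,\ 1+A_2 \end{matrix};1\right)\\ &=\Big(\frac1x\Big)^{1-A_0+A_2}\sum_{n=0}^\infty\Big(\frac1x\Big)^n\frac{(\frac12+A_2)_n(1-A_0+A_2)_n(A_{+-++})_n(A_{+-+-})_n}{n!\,(1+A_2)_n(1+A_2-A_3)_n(1+A_2+A_3)_n}\\ &\qquad\times{}_4F_3\!\left(\begin{matrix} -n,\ -A_0-A_2-n,\ A_{-+++},\ A_{-++-} \\ A_{-+--}-n,\ A_{-+-+}-n,\ 1-A_0+A_2 \end{matrix};1\right)\\ &=\Big(\frac1x\Big)^{1-A_0+A_2}\sum_{n=0}^\infty\Big(\frac1x\Big)^n\frac{(\frac12+A_2)_n(A_{--++})_n(A_{+-++})_n}{n!\,(1+A_2)_n(1+A_2+A_3)_n}\\ &\qquad\times{}_4F_3\!\left(\begin{matrix} -n,\ -A_2-A_3-n,\ A_{+++-},\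 A_{-++-} \\ A_{-+--}-n,\ A_{++--}-n,\ 1+A_2-A_3 \end{matrix};1\right). \end{align*} The function $x^{1-A_0+A_2}f^{(\infty,+A_2)}(A;x)$ is invariant under the change of parameters $A_j\to-A_j$ ($j=0,1,3$).
   Context: Notation: $A_{\varepsilon_0\varepsilon_1\varepsilon_2\varepsilon_3}=(\varepsilon_0A_0+\varepsilon_1A_1+\varepsilon_2A_2+\varepsilon_3A_3+1)/2$ for signs $\varepsilon_j=\pm$; $(a)_n=a(a+1)\cdots(a+n-1)$; ${}_4F_3$ is the generalized hypergeometric series. "Normalized" solution at $x=\infty$ with exponent $\rho$ means a solution of the form $(1/x)^\rho\sum_{n\ge0}C_n(1/x)^n$ with $C_0=1$. Generic means outside a countable union of proper algebraic hypersurfaces of the parameter space. With $\partial=d/dx$, $Z(A)=p_0\partial^4+p_1\partial^3+p_2\partial^2+p_3\partial+p_4$, where \begin{align*} p_0&=x^3(x-1)^2,\qquad p_1=-2x^2(x-1)(2A_0x-2A_0-5x+3),\\ p_2&=x\big[(6A_0^2-A_2^2-A_3^2-24A_0+25)x^2+(-11A_0^2-A_1^2+A_2^2+A_3^2+36A_0-\tfrac{59}2)x+\tfrac14(10A_0-9)(2A_0-3)\big],\\ p_3&=-(2A_0-3)(2A_0^2-A_2^2-A_3^2-6A_0+5)x^2+(A_0-1)(6A_0^2+2A_1^2-2A_2^2-2A_3^2-16A_0+11)x-\tfrac14(2A_0-3)(2A_0-1)^2,\\ p_4&=(A_0-1+A_3)(A_0-1-A_3)(A_0-1+A_2)(A_0-1-A_2)\,x-\tfrac14(2A_0-1)^2(A_0^2+A_1^2-A_2^2-A_3^2-2A_0+1).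 \end{align*} Its local exponents at $x=\infty$ are $1-A_0\pm A_2,\ 1-A_0\pm A_3$. *)

theory Defs
  imports "HOL-Analysis.Analysis"
begin

text \<open>
  Parameters \<open>A = (A\<^sub>0, A\<^sub>1, A\<^sub>2, A\<^sub>3)\<close> are vectors in \<open>complex ^ 4\<close> with components
  \<open>A $ 0, \<dots>, A $ 3\<close>; in the index type \<open>4\<close> these four numerals are distinct and exhaustive
  (\<open>0 = 4\<close>).
\<close>

inductive polynomial_fun :: "(complex ^ 'n \<Rightarrow> complex) \<Rightarrow> bool" where
  const: "polynomial_fun (\<lambda>_. c)"
| coord: "polynomial_fun (\<lambda>z. z $ i)"
| add: "polynomial_fun f \<Longrightarrow> polynomial_fun g \<Longrightarrow> polynomial_fun (\<lambda>z. f z + g z)"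
| mult: "polynomial_fun f \<Longrightarrow> polynomial_fun g \<Longrightarrow> polynomial_fun (\<lambda>z. f z * g z)"

definition algebraic_hypersurface :: "(complex ^ 'n) set \<Rightarrow> bool" where
  "algebraic_hypersurface H \<longleftrightarrow>
     (\<exists>p. polynomial_fun p \<and> (\<exists>z w. p z \<noteq> p w) \<and> H = {z. p z = 0})"

definition for_generic :: "(complex ^ 'n \<Rightarrow> bool) \<Rightarrow> bool" where
  "for_generic P \<longleftrightarrow>
     (\<exists>\<H>. countable \<H> \<and> (\<forall>H\<in>\<H>. algebraic_hypersurface H) \<and> (\<forall>A. A \<notin> \<Union>\<H> \<longrightarrow> P A))"

text \<open>\<open>A\<^bsub>\<epsilon>\<^sub>0\<epsilon>\<^sub>1\<epsilon>\<^sub>2\<epsilon>\<^sub>3\<^esub>\<close>; the signs are passed as \<open>1\<close> and \<open>-1\<close>.\<close>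

definition Aeps :: "complex ^ 4 \<Rightarrow> complex \<Rightarrow> complex \<Rightarrow> complex \<Rightarrow> complex \<Rightarrow> complex" where
  "Aeps A e0 e1 e2 e3 = (e0 * A $ 0 + e1 * A $ 1 + e2 * A $ 2 + e3 * A $ 3 + 1) / 2"

text \<open>The generalized hypergeometric series with upper parameters \<open>us\<close> and lower parameters \<open>ls\<close>.\<close>

definition hypergeom :: "complex list \<Rightarrow> complex list \<Rightarrow> complex \<Rightarrow> complex" where
  "hypergeom us ls z =
     (\<Sum>k. (\<Prod>u\<leftarrow>us. pochhammer u k) / (\<Prod>l\<leftarrow>ls. pochhammer l k) * z ^ k / fact k)"

definition p0 :: "complex ^ 4 \<Rightarrow> complex \<Rightarrow> complex" where
  "p0 A x = x ^ 3 * (x - 1) ^ 2"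

definition p1 :: "complex ^ 4 \<Rightarrow> complex \<Rightarrow> complex" where
  "p1 A x = - 2 * x ^ 2 * (x - 1) * (2 * A $ 0 * x - 2 * A $ 0 - 5 * x + 3)"

definition p2 :: "complex ^ 4 \<Rightarrow> complex \<Rightarrow> complex" where
  "p2 A x = x *
     ((6 * (A $ 0) ^ 2 - (A $ 2) ^ 2 - (A $ 3) ^ 2 - 24 * A $ 0 + 25) * x ^ 2
      + (- 11 * (A $ 0) ^ 2 - (A $ 1) ^ 2 + (A $ 2) ^ 2 + (A $ 3) ^ 2 + 36 * A $ 0 - 59 / 2) * x
      + 1 / 4 * (10 * A $ 0 - 9) * (2 * A $ 0 - 3))"

definition p3 :: "complex ^ 4 \<Rightarrow> complex \<Rightarrow> complex" where
  "p3 A x =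
     - (2 * A $ 0 - 3) * (2 * (A $ 0) ^ 2 - (A $ 2) ^ 2 - (A $ 3) ^ 2 - 6 * A $ 0 + 5) * x ^ 2
     + (A $ 0 - 1) * (6 * (A $ 0) ^ 2 + 2 * (A $ 1) ^ 2 - 2 * (A $ 2) ^ 2 - 2 * (A $ 3) ^ 2
          - 16 * A $ 0 + 11) * x
     - 1 / 4 * (2 * A $ 0 - 3) * (2 * A $ 0 - 1) ^ 2"

definition p4 :: "complex ^ 4 \<Rightarrow> complex \<Rightarrow> complex" where
  "p4 A x =
     (A $ 0 - 1 + A $ 3) * (A $ 0 - 1 - A $ 3) * (A $ 0 - 1 + A $ 2) * (A $ 0 - 1 - A $ 2) * x
     - 1 / 4 * (2 * A $ 0 - 1) ^ 2
         * ((A $ 0) ^ 2 + (A $ 1) ^ 2 - (A $ 2) ^ 2 - (A $ 3) ^ 2 - 2 * A $ 0 + 1)"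

definition Z :: "complex ^ 4 \<Rightarrow> (complex \<Rightarrow> complex) \<Rightarrow> complex \<Rightarrow> complex" where
  "Z A f x = p0 A x * (deriv ^^ 4) f x + p1 A x * (deriv ^^ 3) f x + p2 A x * (deriv ^^ 2) f x
     + p3 A x * deriv f x + p4 A x * f x"

text \<open>
  \<open>(1/x)\<^sup>\<rho> \<Sum>\<^sub>n C\<^sub>n (1/x)\<^sup>n\<close>. Powers are principal, so these multivalued expressions are
  only considered on the plane slit along the nonpositive real axis.
\<close>

definition frobenius_inf :: "complex \<Rightarrow> (nat \<Rightarrow> complex) \<Rightarrow> complex \<Rightarrow> complex" where
  "frobenius_inf \<rho> C x = (1 / x) powr \<rho> * (\<Sum>n. C n * (1 / x) ^ n)"

definition normalized_solution_inf :: "complex ^ 4 \<Rightarrow> complex \<Rightarrow> (nat \<Rightarrow> complex) \<Rightarrow> bool" where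
  "normalized_solution_inf A \<rho> C \<longleftrightarrow> C 0 = 1 \<and>
     (\<forall>\<^sub>F x in at_infinity. x \<notin> \<real>\<^sub>\<le>\<^sub>0 \<longrightarrow>
        summable (\<lambda>n. C n * (1 / x) ^ n) \<and> Z A (frobenius_inf \<rho> C) x = 0)"

definition rho_A2 :: "complex ^ 4 \<Rightarrow> complex" where
  "rho_A2 A = 1 - A $ 0 + A $ 2"

text \<open>
  The solution \<open>f\<^bsup>(\<infinity>,+A\<^sub>2)\<^esup>(A;x)\<close>; meaningful when the normalized solution exists and is unique.
\<close>

definition f_inf_A2 :: "complex ^ 4 \<Rightarrow> complex \<Rightarrow> complex" where
  "f_inf_A2 A = frobenius_inf (rho_A2 A) (THE C. normalized_solution_inf A (rho_A2 A) C)"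

definition coeff_I :: "complex ^ 4 \<Rightarrow> nat \<Rightarrow> complex" where
  "coeff_I A n =
     pochhammer (1/2 + A $ 2) n * pochhammer (Aeps A (-1) (-1) 1 (-1)) n
       * pochhammer (Aeps A 1 (-1) 1 1) n
     / (fact n * pochhammer (1 + A $ 2 - A $ 3) n * pochhammer (1 + A $ 2 + A $ 3) n)
     * hypergeom
         [- of_nat n, - A $ 2 - of_nat n, Aeps A (-1) 1 1 1, Aeps A 1 1 1 (-1)]
         [Aeps A (-1) 1 (-1) (-1) - of_nat n, Aeps A 1 1 (-1) 1 - of_nat n, 1 + A $ 2] 1"

definition coeff_II :: "complex ^ 4 \<Rightarrow> nat \<Rightarrow> complex" where
  "coeff_II A n =
     pochhammer (1/2 + A $ 2) n * pochhammer (1 - A $ 0 + A $ 2) n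
       * pochhammer (Aeps A 1 (-1) 1 1) n * pochhammer (Aeps A 1 (-1) 1 (-1)) n
     / (fact n * pochhammer (1 + A $ 2) n * pochhammer (1 + A $ 2 - A $ 3) n
        * pochhammer (1 + A $ 2 + A $ 3) n)
     * hypergeom
         [- of_nat n, - A $ 0 - A $ 2 - of_nat n, Aeps A (-1) 1 1 1, Aeps A (-1) 1 1 (-1)]
         [Aeps A (-1) 1 (-1) (-1) - of_nat n, Aeps A (-1) 1 (-1) 1 - of_nat n,
          1 - A $ 0 + A $ 2] 1"

definition coeff_III :: "complex ^ 4 \<Rightarrow> nat \<Rightarrow> complex" where
  "coeff_III A n =
     pochhammer (1/2 + A $ 2) n * pochhammer (Aeps A (-1) (-1) 1 1) n
       * pochhammer (Aeps A 1 (-1) 1 1) n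
     / (fact n * pochhammer (1 + A $ 2) n * pochhammer (1 + A $ 2 + A $ 3) n)
     * hypergeom
         [- of_nat n, - A $ 2 - A $ 3 - of_nat n, Aeps A 1 1 1 (-1), Aeps A (-1) 1 1 (-1)]
         [Aeps A (-1) 1 (-1) (-1) - of_nat n, Aeps A 1 1 (-1) (-1) - of_nat n,
          1 + A $ 2 - A $ 3] 1"

text \<open>The sign changes of \<open>A\<^sub>0\<close>, \<open>A\<^sub>1\<close>, \<open>A\<^sub>3\<close>; again the signs are \<open>\<plusminus>1\<close>.\<close>

definition sign_change :: "complex \<Rightarrow> complex \<Rightarrow> complex \<Rightarrow> complex ^ 4 \<Rightarrow> complex ^ 4" where
  "sign_change s0 s1 s3 A =
     (\<chi> j. if j = 0 then s0 * A $ 0 else if j = 1 then s1 * A $ 1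
           else if j = 2 then A $ 2 else s3 * A $ 3)"

end

theory Submission
  imports Defs "HOL-Complex_Analysis.Cauchy_Integral_Formula"
begin

text \<open>
  Write \<open>y = 1/x\<close>. At \<open>x = \<infinity>\<close> the equation \<open>Z(A) f = 0\<close> is a three-term recurrence for the
  coefficients \<open>C\<^sub>n\<close>. Written in \<open>\<nu> = n + A\<^sub>2\<close> it contains only the squares of
  \<open>A\<^sub>0, A\<^sub>1, A\<^sub>3\<close>, which gives the invariance. Reversing Pochhammer symbols turns each of the three
  balanced \<open>\<^sub>4F\<^sub>3(1)\<close> expressions into a quotient of Pochhammer symbols times the \<open>n\<close>-th
  coefficient \<open>\<Sum>\<^bsub>j+k=n\<^esub> u\<^sub>j v\<^sub>k\<close> of a product of two series \<open>\<^sub>2F\<^sub>1(y)\<close>.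
  The contiguity relations of \<open>u\<close> and \<open>v\<close> exchange \<open>j(j+e-1)\<close> at level \<open>n + 1\<close> for
  \<open>(j+a)(j+b)\<close> at level \<open>n\<close>, and likewise for \<open>k\<close>; on \<open>j + k = n\<close> both pairs of quadratics generate
  the unit ideal, and applying the Bezout identity at two consecutive levels yields the recurrence.
  The series converge for \<open>\<bar>y\<bar> < 1\<close> because the products of two series do. Genericity means that
  \<open>A\<^sub>0, A\<^sub>1, A\<^sub>2, A\<^sub>3, 1\<close> satisfy no integer relation involving some \<open>A\<^sub>j\<close>.
\<close>

section \<open>Convolutions of hypergeometric coefficients\<close>

text \<open>Taylor coefficients of the series 2F1(a, b; e; y) at y = 0.\<close>

definition hyp_coeff :: "complex \<Rightarrow> complex \<Rightarrow> complex \<Rightarrow> nat \<Rightarrow> complex" where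
  "hyp_coeff a b e n = pochhammer a n * pochhammer b n / (fact n * pochhammer e n)"

lemma hyp_coeff_0 [simp]: "hyp_coeff a b e 0 = 1"
  by (simp add: hyp_coeff_def)

text \<open>The left factor is kept as j(j + e - 1) at j = n + 1: it vanishes at j = 0, so shifting
  a summation index later leaves no boundary term.\<close>

lemma hyp_coeff_Suc:
  assumes "e + of_nat n \<noteq> 0"
  shows "of_nat (Suc n) * (of_nat (Suc n) + e - 1) * hyp_coeff a b e (Suc n) =
    (of_nat n + a) * (of_nat n + b) * hyp_coeff a b e n"
proof -
  have "of_nat (Suc n) \<noteq> (0::complex)"
    using of_nat_neq_0 by blast
  with assms show ?thesis
    by (simp add: hyp_coeff_def pochhammer_Suc divide_simps del: of_nat_Suc) (simp add: algebra_simps)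
qed

lemma pochhammer_reverse:
  fixes a :: "'a :: comm_ring_1"
  assumes "k \<le> n"
  shows "pochhammer a n = (- 1) ^ k * pochhammer a (n - k) * pochhammer (1 - a - of_nat n) k"
proof -
  have "pochhammer (1 - a - of_nat n) k = (- 1) ^ k * pochhammer (a + of_nat (n - k)) k"
    using pochhammer_minus[of "a + of_nat n - 1" k] assms by (simp add: of_nat_diff algebra_simps)
  then have "(- 1) ^ k * pochhammer (1 - a - of_nat n) k = pochhammer (a + of_nat (n - k)) k"
    by (simp add: mult.assoc[symmetric] power_mult_distrib[symmetric])
  moreover have "pochhammer a n = pochhammer a (n - k) * pochhammer (a + of_nat (n - k)) k"
    using pochhammer_product[of "n - k" n a] assms by simp
  ultimately show ?thesis
    by (metis mult.assoc mult.left_commute)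
qed

lemma pochhammer_neq_0:
  fixes a :: "'a :: field_char_0"
  assumes "\<And>k. a + of_nat k \<noteq> 0"
  shows "pochhammer a n \<noteq> 0"
  using assms by (auto simp: pochhammer_eq_0_iff add_eq_0_iff2)

text \<open>Four symbols have a parameter containing -n: two upper ones, -n and 1 - e - n, and two
  lower ones. Reversing all four turns the k-th term into the (n - k)-th coefficient of 2F1(a, b; e)
  times the k-th coefficient of 2F1(c, d; f), and the four signs (-1)^k cancel.\<close>

lemma hypergeom_4F3_conv:
  assumes "\<And>k. a + of_nat k \<noteq> 0" "\<And>k. b + of_nat k \<noteq> 0" "\<And>k. e + of_nat k \<noteq> 0"
  shows "pochhammer a n * pochhammer b n / fact n *
      hypergeom [- of_nat n, 1 - e - of_nat n, c, d] [1 - a - of_nat n, 1 - b - of_nat n, f] 1 =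
    pochhammer e n * (\<Sum>i\<le>n. hyp_coeff a b e i * hyp_coeff c d f (n - i))"
proof -
  define T where "T k = pochhammer (- of_nat n) k * pochhammer (1 - e - of_nat n) k
    * pochhammer c k * pochhammer d k / (pochhammer (1 - a - of_nat n) k *
      pochhammer (1 - b - of_nat n) k * pochhammer f k) / fact k" for k
  have "hypergeom [- of_nat n, 1 - e - of_nat n, c, d] [1 - a - of_nat n, 1 - b - of_nat n, f] 1
      = (\<Sum>k. T k)"
    by (simp add: hypergeom_def T_def mult_ac)
  \<comment> \<open>For k > n the symbol (-n)_k is 0, and the term is 0 even where a lower symbol
    vanishes as well.\<close>
  also have "\<dots> = (\<Sum>k\<le>n. T k)"
    by (intro suminf_finite) (auto simp: T_def pochhammer_of_nat_eq_0_lemma)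
  finally have "pochhammer a n * pochhammer b n / fact n *
      hypergeom [- of_nat n, 1 - e - of_nat n, c, d] [1 - a - of_nat n, 1 - b - of_nat n, f] 1
      = (\<Sum>k\<le>n. pochhammer a n * pochhammer b n / fact n * T k)"
    by (simp add: sum_distrib_left)
  also have "\<dots> = (\<Sum>k\<le>n. pochhammer e n * (hyp_coeff a b e (n - k) * hyp_coeff c d f k))"
  proof (rule sum.cong)
    fix k assume "k \<in> {..n}"
    then have k: "k \<le> n" by simp
    define s where "s = (- 1 :: complex) ^ k"
    have s: "s * s = 1" "s \<noteq> 0"
      by (simp_all add: s_def power_mult_distrib[symmetric])
    have rev: "pochhammer z n = s * pochhammer z (n - k) * pochhammer (1 - z - of_nat n) k" for z
      unfolding s_def by (rule pochhammer_reverse[OF k])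
    \<comment> \<open>Since n! = (1)_n, the reversal at z = 1 produces the upper parameter
      -n.\<close>
    have 1: "(fact n :: complex) = s * fact (n - k) * pochhammer (- of_nat n) k"
      using rev[of 1] by (simp add: pochhammer_fact)
    have nz: "pochhammer a n \<noteq> 0" "pochhammer b n \<noteq> 0" "pochhammer e n \<noteq> 0" "(fact n :: complex) \<noteq> 0"
      using assms by (simp_all add: pochhammer_neq_0)
    note nz' = nz(1)[unfolded rev[of a]] nz(2)[unfolded rev[of b]] nz(3)[unfolded rev[of e]] nz(4)[unfolded 1]
    show "pochhammer a n * pochhammer b n / fact n * T k
        = pochhammer e n * (hyp_coeff a b e (n - k) * hyp_coeff c d f k)"
      unfolding T_def hyp_coeff_def rev[of a] rev[of b] rev[of e] 1
      using nz' s(1) by (simp add: divide_simps)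
  qed simp
  also have "\<dots> = (\<Sum>i\<le>n. pochhammer e n * (hyp_coeff a b e i * hyp_coeff c d f (n - i)))"
    by (rule sum.reindex_bij_witness[of _ "\<lambda>i. n - i" "\<lambda>i. n - i"]) auto
  finally show ?thesis
    by (simp add: sum_distrib_left)
qed

text \<open>The weight kills the term i = 0. The extra factor \<open>p\<close> depends only on the
  second index, which stays fixed while i and the level both drop by one.
  \<open>conv_shift_right\<close> is the mirror image, where the last term vanishes.\<close>

lemma conv_shift_left:
  fixes u v :: "nat \<Rightarrow> 'a :: comm_ring_1"
  assumes "\<And>j. of_nat (Suc j) * (of_nat (Suc j) + e - 1) * u (Suc j) = (of_nat j + a) * (of_nat j + b) * u j"
  shows "(\<Sum>i\<le>Suc n. p (Suc n - i) * (of_nat i * (of_nat i + e - 1)) * (u i * v (Suc n - i))) =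
    (\<Sum>i\<le>n. p (n - i) * ((of_nat i + a) * (of_nat i + b)) * (u i * v (n - i)))"
proof -
  have "(\<Sum>i\<le>Suc n. p (Suc n - i) * (of_nat i * (of_nat i + e - 1)) * (u i * v (Suc n - i))) =
    (\<Sum>i\<le>n. p (n - i) * (of_nat (Suc i) * (of_nat (Suc i) + e - 1) * u (Suc i)) * v (n - i))"
    by (subst sum.atMost_Suc_shift) (simp add: mult_ac)
  then show ?thesis
    unfolding assms by (simp add: mult_ac)
qed

lemma conv_shift_right:
  fixes u v :: "nat \<Rightarrow> 'a :: comm_ring_1"
  assumes "\<And>j. of_nat (Suc j) * (of_nat (Suc j) + f - 1) * v (Suc j) = (of_nat j + c) * (of_nat j + d) * v j"
  shows "(\<Sum>i\<le>Suc n. q i * (of_nat (Suc n - i) * (of_nat (Suc n - i) + f - 1)) * (u i * v (Suc n - i))) =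
    (\<Sum>i\<le>n. q i * ((of_nat (n - i) + c) * (of_nat (n - i) + d)) * (u i * v (n - i)))"
proof -
  have "(\<Sum>i\<le>Suc n. q i * (of_nat (Suc n - i) * (of_nat (Suc n - i) + f - 1)) * (u i * v (Suc n - i))) =
    (\<Sum>i\<le>n. q i * u i * (of_nat (Suc (n - i)) * (of_nat (Suc (n - i)) + f - 1) * v (Suc (n - i))))"
    unfolding sum.atMost_Suc by (simp add: Suc_diff_le mult_ac del: of_nat_Suc of_nat_diff)
  then show ?thesis
    unfolding assms by (simp add: mult_ac)
qed

text \<open>On the line X + Y = N the quadratics X^2 - u^2 and Y^2 - v^2 become polynomials in one
  variable. The right side is their resultant, the product of N + u + v over all choices of signs of
  u and v.\<close>

lemma bezout_shifted_squares:
  fixes X Y u v N :: "'a :: idom"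
  assumes "N = X + Y"
  shows "(N\<^sup>2 + 2 * N * Y - (u\<^sup>2 - v\<^sup>2)) * ((X - u) * (X + u))
      + (N\<^sup>2 + 2 * N * X + (u\<^sup>2 - v\<^sup>2)) * ((Y - v) * (Y + v))
    = (N\<^sup>2 - (u + v)\<^sup>2) * (N\<^sup>2 - (u - v)\<^sup>2)"
  unfolding assms by algebra

text \<open>The cofactors at level N multiply the quadratics in w and z, and those at level N - 1
  multiply the quadratics in u and v. In the weighted sum everything that depends on how N - 1
  splits into X + Y cancels. One further remainder, a multiple of M (u^2 - v^2)(w^2 - z^2), is
  removed by the third assumption, so the result factors through N (N - 1) M. The factor 2 clears
  halves.\<close>

lemma bezout_compatibility:
  fixes X Y X' Y' u v w z t N M :: complex
  assumes "N = X + Y + 1" "2 * M = 2 * N - 1" "(u\<^sup>2 - v\<^sup>2) * (w\<^sup>2 - z\<^sup>2) = 0"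
    "2 * X' = 2 * X + (1 - t)" "2 * Y' = 2 * Y + (1 + t)"
  shows "2 * ((N - 1) * ((N\<^sup>2 + 2 * N * Y - (u\<^sup>2 - v\<^sup>2)) * ((X' + w) * (X' - w))
        + (N\<^sup>2 + 2 * N * X + (u\<^sup>2 - v\<^sup>2)) * ((Y' + z) * (Y' - z)))
      + N * (((N - 1)\<^sup>2 + 2 * (N - 1) * Y' - (w\<^sup>2 - z\<^sup>2)) * ((X - u) * (X + u))
        + ((N - 1)\<^sup>2 + 2 * (N - 1) * X' + (w\<^sup>2 - z\<^sup>2)) * ((Y - v) * (Y + v))))
    + N * (N - 1) * M * (4 * (u\<^sup>2 + v\<^sup>2 + w\<^sup>2 + z\<^sup>2) - 2 * t\<^sup>2 - 1 - 4 * M\<^sup>2) = 0"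
  using assms by algebra

text \<open>The parameters are read off from exponent differences: the two factors have 2u and 2v at
  y = 0, 2w and 2z at infinity, and t and -t at y = 1. The opposite signs of t give a + b + c + d =
  (2u + 1) + (2v + 1), which corresponds to the 4F3 being balanced.\<close>

lemma conv_rec:
  fixes u v w z t :: complex
  defines "a \<equiv> u + (1 - t) / 2 + w" and "b \<equiv> u + (1 - t) / 2 - w"
    and "c \<equiv> v + (1 + t) / 2 + z" and "d \<equiv> v + (1 + t) / 2 - z"
  defines "\<alpha> \<equiv> hyp_coeff a b (2 * u + 1)" and "\<beta> \<equiv> hyp_coeff c d (2 * v + 1)"
  defines "S \<equiv> \<lambda>n. \<Sum>i\<le>n. \<alpha> i * \<beta> (n - i)"
  assumes degen: "(u\<^sup>2 - v\<^sup>2) * (w\<^sup>2 - z\<^sup>2) = 0"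
    and nz: "\<And>k. 2 * u + 1 + of_nat k \<noteq> 0" "\<And>k. 2 * v + 1 + of_nat k \<noteq> 0"
    and N: "N = of_nat n + 1 + u + v" and M: "M = N - 1 / 2"
  shows "(N - 1) * ((N\<^sup>2 - (u + v)\<^sup>2) * (N\<^sup>2 - (u - v)\<^sup>2)) * S (Suc n)
    + N * (N - 1) * M * (2 * (u\<^sup>2 + v\<^sup>2 + w\<^sup>2 + z\<^sup>2) - t\<^sup>2 - 1 / 2 - 2 * M\<^sup>2) * S n
    + (case n of 0 \<Rightarrow> 0
       | Suc m \<Rightarrow> N * (((N - 1)\<^sup>2 - (w + z)\<^sup>2) * ((N - 1)\<^sup>2 - (w - z)\<^sup>2)) * S m) = 0"
proof -
  have rec_\<alpha>: "of_nat (Suc j) * (of_nat (Suc j) + (2 * u + 1) - 1) * \<alpha> (Suc j) =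
      (of_nat j + a) * (of_nat j + b) * \<alpha> j" for j
    unfolding \<alpha>_def by (rule hyp_coeff_Suc) (rule nz)
  have rec_\<beta>: "of_nat (Suc j) * (of_nat (Suc j) + (2 * v + 1) - 1) * \<beta> (Suc j) =
      (of_nat j + c) * (of_nat j + d) * \<beta> j" for j
    unfolding \<beta>_def by (rule hyp_coeff_Suc) (rule nz)
  note shift_\<alpha> = conv_shift_left[where v = \<beta>, OF rec_\<alpha>] and shift_\<beta> = conv_shift_right[where u = \<alpha>, OF rec_\<beta>]
  \<comment> \<open>\<open>p\<close>, \<open>q\<close> are the Bezout cofactors for u, v on i + j =
    n + 1. \<open>r\<close>, \<open>s\<close> are those for w, z on i + j = n - 1, with the half
    shifts (1 - t)/2 and (1 + t)/2 included.\<close>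
  define p where "p k = N\<^sup>2 + 2 * N * (of_nat k + v) - (u\<^sup>2 - v\<^sup>2)" for k :: nat
  define q where "q k = N\<^sup>2 + 2 * N * (of_nat k + u) + (u\<^sup>2 - v\<^sup>2)" for k :: nat
  define r where "r k = (N - 1)\<^sup>2 + 2 * (N - 1) * (of_nat k + v + (1 + t) / 2) - (w\<^sup>2 - z\<^sup>2)" for k :: nat
  define s where "s k = (N - 1)\<^sup>2 + 2 * (N - 1) * (of_nat k + u + (1 - t) / 2) + (w\<^sup>2 - z\<^sup>2)" for k :: nat
  define W where "W g n = (\<Sum>i\<le>n. g i (n - i) * (\<alpha> i * \<beta> (n - i)))" for g :: "nat \<Rightarrow> nat \<Rightarrow> complex" and n
  have W_const: "x * S k = W (\<lambda>_ _. x) k" for x k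
    by (simp add: S_def W_def sum_distrib_left)
  have W_add: "W g k + W h k = W (\<lambda>i j. g i j + h i j) k" for g h k
    by (simp add: W_def sum.distrib algebra_simps)
  have W_cmult: "x * W g k = W (\<lambda>i j. x * g i j) k" for x g k
    by (simp add: W_def sum_distrib_left mult_ac)
  have W_cong: "W g k = W h k" if "\<And>i j. i + j = k \<Longrightarrow> g i j = h i j" for g h k
    using that by (auto simp: W_def intro!: sum.cong)
  have left: "W (\<lambda>i j. g j * (of_nat i * (of_nat i + (2 * u + 1) - 1))) (Suc k) =
      W (\<lambda>i j. g j * ((of_nat i + a) * (of_nat i + b))) k" for g k
    unfolding W_def by (rule shift_\<alpha>)
  have right: "W (\<lambda>i j. g i * (of_nat j * (of_nat j + (2 * v + 1) - 1))) (Suc k) =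
      W (\<lambda>i j. g i * ((of_nat j + c) * (of_nat j + d))) k" for g k
    unfolding W_def by (rule shift_\<beta>)
  \<comment> \<open>Bezout writes the resultant as a combination of weights that both shift down, so
    \<open>S (Suc n)\<close> becomes a sum at level n.\<close>
  have top: "((N\<^sup>2 - (u + v)\<^sup>2) * (N\<^sup>2 - (u - v)\<^sup>2)) * S (Suc n) =
      W (\<lambda>i j. p j * ((of_nat i + a) * (of_nat i + b)) + q i * ((of_nat j + c) * (of_nat j + d))) n"
  proof -
    have "((N\<^sup>2 - (u + v)\<^sup>2) * (N\<^sup>2 - (u - v)\<^sup>2)) * S (Suc n) =
      W (\<lambda>i j. p j * (of_nat i * (of_nat i + (2 * u + 1) - 1))
           + q i * (of_nat j * (of_nat j + (2 * v + 1) - 1))) (Suc n)"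
      unfolding W_const
    proof (rule W_cong)
      fix i j assume "i + j = Suc n"
      then have "of_nat i + of_nat j = (of_nat n + 1 :: complex)"
        by (metis of_nat_Suc of_nat_add add.commute)
      then have "N = (of_nat i + u) + (of_nat j + v)"
        by (simp add: N algebra_simps)
      from bezout_shifted_squares[OF this, of u v]
      show "(N\<^sup>2 - (u + v)\<^sup>2) * (N\<^sup>2 - (u - v)\<^sup>2) = p j * (of_nat i * (of_nat i + (2 * u + 1) - 1))
           + q i * (of_nat j * (of_nat j + (2 * v + 1) - 1))"
        by (simp add: p_def q_def add_ac)
    qed
    also have "\<dots> = W (\<lambda>i j. p j * ((of_nat i + a) * (of_nat i + b))) n
        + W (\<lambda>i j. q i * ((of_nat j + c) * (of_nat j + d))) n"
      unfolding W_add[symmetric] left right ..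
    finally show ?thesis
      unfolding W_add .
  qed
  \<comment> \<open>Once all three contributions live at level n, the recurrence holds term by
    term.\<close>
  have mid: "(N - 1) * (p j * ((of_nat i + a) * (of_nat i + b)) + q i * ((of_nat j + c) * (of_nat j + d)))
      + N * (N - 1) * M * (2 * (u\<^sup>2 + v\<^sup>2 + w\<^sup>2 + z\<^sup>2) - t\<^sup>2 - 1 / 2 - 2 * M\<^sup>2)
      + N * (r j * (of_nat i * (of_nat i + (2 * u + 1) - 1)) + s i * (of_nat j * (of_nat j + (2 * v + 1) - 1))) = 0"
    if ij: "i + j = n" for i j
  proof -
    define X Y X' Y' where "X = of_nat i + u" and "Y = of_nat j + v"
      and "X' = X + (1 - t) / 2" and "Y' = Y + (1 + t) / 2"
    note XY_defs = X_def Y_def X'_def Y'_def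
    have "of_nat i + of_nat j = (of_nat n :: complex)"
      using ij by (metis of_nat_add)
    then have "N = X + Y + 1"
      by (simp add: N XY_defs algebra_simps)
    then have "2 * ((N - 1) * ((N\<^sup>2 + 2 * N * Y - (u\<^sup>2 - v\<^sup>2)) * ((X' + w) * (X' - w))
          + (N\<^sup>2 + 2 * N * X + (u\<^sup>2 - v\<^sup>2)) * ((Y' + z) * (Y' - z)))
        + N * (((N - 1)\<^sup>2 + 2 * (N - 1) * Y' - (w\<^sup>2 - z\<^sup>2)) * ((X - u) * (X + u))
          + ((N - 1)\<^sup>2 + 2 * (N - 1) * X' + (w\<^sup>2 - z\<^sup>2)) * ((Y - v) * (Y + v))))
      + N * (N - 1) * M * (4 * (u\<^sup>2 + v\<^sup>2 + w\<^sup>2 + z\<^sup>2) - 2 * t\<^sup>2 - 1 - 4 * M\<^sup>2) = 0"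
      by (rule bezout_compatibility[OF _ _ degen]) (simp_all add: M X'_def Y'_def)
    moreover have "p j = N\<^sup>2 + 2 * N * Y - (u\<^sup>2 - v\<^sup>2)" "q i = N\<^sup>2 + 2 * N * X + (u\<^sup>2 - v\<^sup>2)"
      "r j = (N - 1)\<^sup>2 + 2 * (N - 1) * Y' - (w\<^sup>2 - z\<^sup>2)"
      "s i = (N - 1)\<^sup>2 + 2 * (N - 1) * X' + (w\<^sup>2 - z\<^sup>2)"
      by (simp_all add: p_def q_def r_def s_def XY_defs add_ac)
    moreover have "of_nat i * (of_nat i + (2 * u + 1) - 1) = (X - u) * (X + u)"
       "of_nat j * (of_nat j + (2 * v + 1) - 1) = (Y - v) * (Y + v)"
       "of_nat i + a = X' + w" "of_nat i + b = X' - w" "of_nat j + c = Y' + z" "of_nat j + d = Y' - z"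
      by (simp_all add: XY_defs a_def b_def c_def d_def add_ac)
    ultimately show ?thesis
      by (simp only:) algebra
  qed
  \<comment> \<open>Here the shift and the Bezout identity are used in the opposite order: a sum at
    level n descends to level n - 1, where the cofactors for w, z collapse it to a multiple of
    \<open>S m\<close>. At n = 0 the factors i and j vanish.\<close>
  have bot: "N * W (\<lambda>i j. r j * (of_nat i * (of_nat i + (2 * u + 1) - 1))
        + s i * (of_nat j * (of_nat j + (2 * v + 1) - 1))) n =
      (case n of 0 \<Rightarrow> 0
       | Suc m \<Rightarrow> N * (((N - 1)\<^sup>2 - (w + z)\<^sup>2) * ((N - 1)\<^sup>2 - (w - z)\<^sup>2)) * S m)"
  proof (cases n)
    case 0
    then show ?thesis by (simp add: W_def)
  next
    case (Suc m)
    have "W (\<lambda>i j. r j * (of_nat i * (of_nat i + (2 * u + 1) - 1))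
        + s i * (of_nat j * (of_nat j + (2 * v + 1) - 1))) n =
      W (\<lambda>i j. r j * ((of_nat i + a) * (of_nat i + b))) m
        + W (\<lambda>i j. s i * ((of_nat j + c) * (of_nat j + d))) m"
      unfolding Suc W_add[symmetric] left right ..
    also have "\<dots> = W (\<lambda>_ _. ((N - 1)\<^sup>2 - (w + z)\<^sup>2) * ((N - 1)\<^sup>2 - (w - z)\<^sup>2)) m"
      unfolding W_add
    proof (rule W_cong)
      fix i j assume "i + j = m"
      then have "of_nat i + of_nat j + 1 = (of_nat n :: complex)"
        using Suc by (metis of_nat_Suc of_nat_add add.commute)
      then have "N - 1 = (of_nat i + u + (1 - t) / 2) + (of_nat j + v + (1 + t) / 2)"
        by (simp add: N add_divide_distrib diff_divide_distrib flip: \<open>of_nat i + of_nat j + 1 = of_nat n\<close>)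
      from bezout_shifted_squares[OF this, of w z]
      show "r j * ((of_nat i + a) * (of_nat i + b)) + s i * ((of_nat j + c) * (of_nat j + d))
        = ((N - 1)\<^sup>2 - (w + z)\<^sup>2) * ((N - 1)\<^sup>2 - (w - z)\<^sup>2)"
        unfolding r_def s_def a_def b_def c_def d_def by (simp add: algebra_simps)
    qed
    finally show ?thesis
      unfolding W_const[symmetric] by (simp add: Suc mult_ac)
  qed
  have "W (\<lambda>i j. (N - 1) * (p j * ((of_nat i + a) * (of_nat i + b)) + q i * ((of_nat j + c) * (of_nat j + d)))
      + N * (N - 1) * M * (2 * (u\<^sup>2 + v\<^sup>2 + w\<^sup>2 + z\<^sup>2) - t\<^sup>2 - 1 / 2 - 2 * M\<^sup>2)
      + N * (r j * (of_nat i * (of_nat i + (2 * u + 1) - 1)) + s i * (of_nat j * (of_nat j + (2 * v + 1) - 1)))) n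
      = W (\<lambda>_ _. 0) n"
    by (intro W_cong mid)
  also have "\<dots> = 0"
    by (simp add: W_def)
  finally show ?thesis
    unfolding bot[symmetric] mult.assoc[of "N - 1"] top unfolding W_const W_cmult W_add
    by (simp only: mult.assoc)
qed

section \<open>Frobenius series at infinity\<close>

text \<open>The series with coefficients n c(n) is y times the formal derivative, which converges in
  the same disc.\<close>

lemma conv_radius_linear_factor:
  fixes c :: "nat \<Rightarrow> complex"
  shows "conv_radius (\<lambda>n. (s + of_nat n) * c n) \<ge> conv_radius c"
proof -
  have shifted: "conv_radius (\<lambda>n. of_nat n * c n) \<ge> conv_radius c"
  proof (rule conv_radius_geI_ex')
    fix r :: real assume r: "0 < r" "ereal r < conv_radius c"
    then obtain K where K: "r < K" "ereal K < conv_radius c"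
      using ereal_dense2 by force
    have "summable (\<lambda>n. diffs c n * of_real r ^ n)"
    proof (rule termdiff_converges)
      show "norm (of_real r :: complex) < K"
        using r K by simp
      show "summable (\<lambda>n. c n * x ^ n)" if "norm x < K" for x
        using K that by (intro summable_in_conv_radius) (rule less_trans[of _ "ereal K"], simp_all)
    qed
    then have "summable (\<lambda>n. of_real r * (diffs c n * of_real r ^ n))"
      by (rule summable_mult)
    then have "summable (\<lambda>n. of_nat (Suc n) * c (Suc n) * of_real r ^ Suc n)"
      by (simp add: diffs_def mult_ac)
    then show "summable (\<lambda>n. of_nat n * c n * of_real r ^ n)"
      using summable_Suc_iff[of "\<lambda>n. of_nat n * c n * of_real r ^ n"] by blast
  qed
  show ?thesis
  proof (rule conv_radius_geI_ex')
    fix r :: real assume r: "0 < r" "ereal r < conv_radius c"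
    have "summable (\<lambda>n. s * (c n * of_real r ^ n) + of_nat n * c n * of_real r ^ n)"
      using r shifted by (intro summable_add summable_mult summable_in_conv_radius) auto
    then show "summable (\<lambda>n. (s + of_nat n) * c n * of_real r ^ n)"
      by (simp add: algebra_simps)
  qed
qed

lemma inverse_in_nonpos_Reals_iff:
  fixes x :: complex
  shows "1 / x \<in> \<real>\<^sub>\<le>\<^sub>0 \<longleftrightarrow> x \<in> \<real>\<^sub>\<le>\<^sub>0"
  by (simp add: divide_inverse)

text \<open>Termwise, x^(-\<rho> - n) has derivative -(\<rho> + n) x^(-\<rho> - 1 - n). The result
  is again a \<open>frobenius_inf\<close>, with exponent raised by one, so the rule can be
  iterated.\<close>

lemma DERIV_frobenius_inf:
  assumes "norm (1 / x) < conv_radius C" "x \<notin> \<real>\<^sub>\<le>\<^sub>0"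
  shows "(frobenius_inf \<rho> C has_field_derivative
    frobenius_inf (\<rho> + 1) (\<lambda>n. - (\<rho> + of_nat n) * C n) x) (at x)"
proof -
  define y where "y = 1 / x"
  have x: "x \<noteq> 0" and y: "y \<notin> \<real>\<^sub>\<le>\<^sub>0" "y \<noteq> 0" "norm y < conv_radius C"
    using assms by (auto simp: inverse_in_nonpos_Reals_iff y_def)
  obtain K where K: "norm y < K" "ereal K < conv_radius C"
    using ereal_dense2 y(3) by force
  have sumC: "summable (\<lambda>n. C n * z ^ n)" if "norm z < K" for z
    using K that by (intro summable_in_conv_radius) (rule less_trans[of _ "ereal K"], simp_all)
  have S: "((\<lambda>z. \<Sum>n. C n * z ^ n) has_field_derivative (\<Sum>n. diffs C n * y ^ n)) (at y)"
    by (rule termdiffs_strong'[OF sumC K(1)])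
  have "((\<lambda>z. z powr \<rho> * (\<Sum>n. C n * z ^ n)) has_field_derivative
      (\<rho> * y powr (\<rho> - 1) * (\<Sum>n. C n * y ^ n) + (\<Sum>n. diffs C n * y ^ n) * y powr \<rho>)) (at y)"
    by (rule DERIV_mult[OF has_field_derivative_powr[OF y(1)] S])
  moreover have "((\<lambda>x. 1 / x) has_field_derivative - (y\<^sup>2)) (at x)"
    using x by (auto intro!: derivative_eq_intros simp: y_def power2_eq_square)
  ultimately have "((\<lambda>x. (1 / x) powr \<rho> * (\<Sum>n. C n * (1 / x) ^ n)) has_field_derivative
      ((\<rho> * y powr (\<rho> - 1) * (\<Sum>n. C n * y ^ n) + (\<Sum>n. diffs C n * y ^ n) * y powr \<rho>) * - (y\<^sup>2))) (at x)"
    unfolding y_def by (rule DERIV_chain2)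
  moreover have "(\<rho> * y powr (\<rho> - 1) * (\<Sum>n. C n * y ^ n) + (\<Sum>n. diffs C n * y ^ n) * y powr \<rho>) * - (y\<^sup>2)
      = frobenius_inf (\<rho> + 1) (\<lambda>n. - (\<rho> + of_nat n) * C n) x"
  proof -
    have "summable (\<lambda>n. diffs C n * y ^ n)"
      by (rule termdiff_converges[OF K(1) sumC])
    then have "(\<lambda>n. y * (diffs C n * y ^ n)) sums (y * (\<Sum>n. diffs C n * y ^ n))"
      by (intro sums_mult summable_sums)
    then have "(\<lambda>n. of_nat (Suc n) * C (Suc n) * y ^ Suc n) sums (y * (\<Sum>n. diffs C n * y ^ n))"
      by (simp add: diffs_def mult_ac)
    from this[THEN sums_Suc] have "(\<lambda>n. of_nat n * C n * y ^ n) sums (y * (\<Sum>n. diffs C n * y ^ n))"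
      by simp
    moreover have "(\<lambda>n. \<rho> * (C n * y ^ n)) sums (\<rho> * (\<Sum>n. C n * y ^ n))"
      using sumC[OF K(1)] by (intro sums_mult summable_sums)
    ultimately have "(\<lambda>n. - (\<rho> * (C n * y ^ n) + of_nat n * C n * y ^ n)) sums
      - (\<rho> * (\<Sum>n. C n * y ^ n) + y * (\<Sum>n. diffs C n * y ^ n))"
      by (intro sums_minus sums_add)
    then have "(\<Sum>n. - (\<rho> + of_nat n) * C n * y ^ n) = - (\<rho> * (\<Sum>n. C n * y ^ n) + y * (\<Sum>n. diffs C n * y ^ n))"
      by (simp add: sums_iff algebra_simps)
    moreover have "y powr (\<rho> + 1) = y powr \<rho> * y" "y powr (\<rho> - 1) = y powr \<rho> / y"
      using y by (simp_all add: powr_add powr_diff)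
    ultimately show ?thesis
      unfolding frobenius_inf_def y_def[symmetric]
      by (simp only:) (use y in \<open>simp add: field_simps power2_eq_square\<close>)
  qed
  ultimately show ?thesis
    by (simp add: frobenius_inf_def[abs_def])
qed

text \<open>The two claims go together: each further differentiation requires that the coefficients
  obtained so far still converge at 1/x.\<close>

lemma funpow_deriv_frobenius_inf:
  assumes "norm (1 / x) < conv_radius C" "x \<notin> \<real>\<^sub>\<le>\<^sub>0"
  shows "(deriv ^^ k) (frobenius_inf \<rho> C) x =
    frobenius_inf (\<rho> + of_nat k) (\<lambda>n. (- 1) ^ k * pochhammer (\<rho> + of_nat n) k * C n) x"
    and "conv_radius (\<lambda>n. (- 1) ^ k * pochhammer (\<rho> + of_nat n) k * C n) \<ge> conv_radius C"
proof -
  define D where "D k n = (- 1) ^ k * pochhammer (\<rho> + of_nat n) k * C n" for k n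
  have D_Suc: "D (Suc k) = (\<lambda>n. - (\<rho> + of_nat k + of_nat n) * D k n)" for k
    by (simp add: D_def pochhammer_Suc fun_eq_iff algebra_simps)
  have radius: "conv_radius (D k) \<ge> conv_radius C" for k
  proof (induction k)
    case 0
    then show ?case by (simp add: D_def)
  next
    case (Suc k)
    have "conv_radius (D k) \<le> conv_radius (\<lambda>n. (\<rho> + of_nat k + of_nat n) * D k n)"
      by (rule conv_radius_linear_factor)
    also have "\<dots> = conv_radius (\<lambda>n. (- 1) * ((\<rho> + of_nat k + of_nat n) * D k n))"
      by (rule conv_radius_cmult_left[symmetric]) simp
    also have "(\<lambda>n. (- 1) * ((\<rho> + of_nat k + of_nat n) * D k n)) = D (Suc k)"
      by (simp add: D_Suc fun_eq_iff algebra_simps)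
    finally show ?case
      using Suc by (rule order.trans[rotated])
  qed
  then show "conv_radius (\<lambda>n. (- 1) ^ k * pochhammer (\<rho> + of_nat n) k * C n) \<ge> conv_radius C"
    by (simp add: D_def[abs_def])
  obtain K where K: "norm (1 / x) < K" "ereal K < conv_radius C"
    using ereal_dense2 assms(1) by force
  \<comment> \<open>Each \<open>deriv\<close> needs the previous identity on a neighbourhood, so the
    induction runs on an open set containing x. The inequality says |1/z| < K and also excludes z =
    0.\<close>
  define W :: "complex set" where "W = {z. 1 < K * norm z} - \<real>\<^sub>\<le>\<^sub>0"
  have "open W"
    unfolding W_def by (intro open_Diff open_Collect_less continuous_intros closed_nonpos_Reals_complex)
  have W: "norm (1 / z) < conv_radius C" "z \<notin> \<real>\<^sub>\<le>\<^sub>0" if "z \<in> W" for z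
  proof -
    have "ereal (norm (1 / z)) < K"
      using that by (auto simp: W_def norm_divide divide_simps)
    with K(2) show "norm (1 / z) < conv_radius C"
      using less_trans by blast
  qed (use that in \<open>auto simp: W_def\<close>)
  have "(deriv ^^ k) (frobenius_inf \<rho> C) z = frobenius_inf (\<rho> + of_nat k) (D k) z" if "z \<in> W" for z
    using that
  proof (induction k arbitrary: z)
    case 0
    then show ?case by (simp add: D_def[abs_def])
  next
    case (Suc k)
    have "(frobenius_inf (\<rho> + of_nat k) (D k) has_field_derivative
        frobenius_inf (\<rho> + of_nat k + 1) (D (Suc k)) z) (at z)"
      unfolding D_Suc using W[OF Suc.prems] radius[of k] by (intro DERIV_frobenius_inf) auto
    then have "((deriv ^^ k) (frobenius_inf \<rho> C) has_field_derivative
        frobenius_inf (\<rho> + of_nat k + 1) (D (Suc k)) z) (at z)"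
      by (rule has_field_derivative_transform_within_open[OF _ \<open>open W\<close> Suc.prems]) (simp add: Suc.IH)
    then show ?case
      by (simp add: DERIV_imp_deriv add_ac)
  qed
  moreover have "x \<in> W"
    using assms K(1) by (auto simp: W_def norm_divide divide_simps split: if_splits)
  ultimately show "(deriv ^^ k) (frobenius_inf \<rho> C) x =
    frobenius_inf (\<rho> + of_nat k) (\<lambda>n. (- 1) ^ k * pochhammer (\<rho> + of_nat n) k * C n) x"
    by (simp add: D_def[abs_def])
qed

section \<open>The three-term recurrence attached to the operator at infinity\<close>

definition lead :: "complex ^ 4 \<Rightarrow> complex \<Rightarrow> complex" where
  "lead A \<nu> = (\<nu>\<^sup>2 - (A $ 2)\<^sup>2) * (\<nu>\<^sup>2 - (A $ 3)\<^sup>2)"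

definition mid :: "complex ^ 4 \<Rightarrow> complex \<Rightarrow> complex" where
  "mid A \<mu> = \<mu>\<^sup>2 * ((A $ 0)\<^sup>2 - (A $ 1)\<^sup>2 + (A $ 2)\<^sup>2 + (A $ 3)\<^sup>2 - 1 / 2 - 2 * \<mu>\<^sup>2)"

definition low :: "complex ^ 4 \<Rightarrow> complex \<Rightarrow> complex" where
  "low A \<nu> = (\<nu> + 1 / 2) * (\<nu> - 1 / 2) * (\<nu>\<^sup>2 - (A $ 0)\<^sup>2)"

text \<open>Up to the factor y^\<rho> x, this is the coefficient of y^n in Z(A) applied to the
  series, where y = 1/x. The tests on n stand for C(-1) = C(-2) = 0, since subtraction on naturals
  would return \<open>C 0\<close>.\<close>

definition frob_res :: "complex ^ 4 \<Rightarrow> (nat \<Rightarrow> complex) \<Rightarrow> nat \<Rightarrow> complex" where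
  "frob_res A C n = lead A (of_nat n + A $ 2) * C n
     + (if n = 0 then 0 else mid A (of_nat n - 1 / 2 + A $ 2) * C (n - 1))
     + (if n < 2 then 0 else low A (of_nat n - 1 + A $ 2) * C (n - 2))"

definition frob_rec :: "complex ^ 4 \<Rightarrow> (nat \<Rightarrow> complex) \<Rightarrow> bool" where
  "frob_rec A C \<longleftrightarrow> C 0 = 1 \<and> (\<forall>n. frob_res A C n = 0)"

lemma pochhammer_numerals:
  fixes s :: "'a :: comm_ring_1"
  shows "pochhammer s 2 = s * (s + 1)" "pochhammer s 3 = s * (s + 1) * (s + 2)"
    "pochhammer s 4 = s * (s + 1) * (s + 2) * (s + 3)"
  by (simp_all add: eval_nat_numeral pochhammer_Suc add_ac)

text \<open>Multiplied by y^k, the polynomial in front of the k-th derivative becomes x times a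
  quadratic in y. \<open>top_coeff\<close>, \<open>mid_coeff\<close> and \<open>low_coeff\<close>
  are the coefficients of 1, y and y^2 in that quadratic.\<close>

definition top_coeff :: "complex ^ 4 \<Rightarrow> nat \<Rightarrow> complex" where
  "top_coeff A k = [(A $ 0 - 1 + A $ 3) * (A $ 0 - 1 - A $ 3) * (A $ 0 - 1 + A $ 2) * (A $ 0 - 1 - A $ 2),
     - (2 * A $ 0 - 3) * (2 * (A $ 0)\<^sup>2 - (A $ 2)\<^sup>2 - (A $ 3)\<^sup>2 - 6 * A $ 0 + 5),
     6 * (A $ 0)\<^sup>2 - (A $ 2)\<^sup>2 - (A $ 3)\<^sup>2 - 24 * A $ 0 + 25,
     - 2 * (2 * A $ 0 - 5),
     1] ! k"

definition mid_coeff :: "complex ^ 4 \<Rightarrow> nat \<Rightarrow> complex" where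
  "mid_coeff A k = [- 1 / 4 * (2 * A $ 0 - 1)\<^sup>2
         * ((A $ 0)\<^sup>2 + (A $ 1)\<^sup>2 - (A $ 2)\<^sup>2 - (A $ 3)\<^sup>2 - 2 * A $ 0 + 1),
     (A $ 0 - 1) * (6 * (A $ 0)\<^sup>2 + 2 * (A $ 1)\<^sup>2 - 2 * (A $ 2)\<^sup>2 - 2 * (A $ 3)\<^sup>2
          - 16 * A $ 0 + 11),
     - 11 * (A $ 0)\<^sup>2 - (A $ 1)\<^sup>2 + (A $ 2)\<^sup>2 + (A $ 3)\<^sup>2 + 36 * A $ 0 - 59 / 2,
     8 * A $ 0 - 16,
     - 2] ! k"

definition low_coeff :: "complex ^ 4 \<Rightarrow> nat \<Rightarrow> complex" where
  "low_coeff A k = [0,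
     - 1 / 4 * (2 * A $ 0 - 3) * (2 * A $ 0 - 1)\<^sup>2,
     1 / 4 * (10 * A $ 0 - 9) * (2 * A $ 0 - 3),
     - 2 * (2 * A $ 0 - 3),
     1] ! k"

lemma sum_upto_4: "(\<Sum>k\<le>4. f k) = f 0 + f 1 + f 2 + f 3 + (f 4 :: complex)" for f :: "nat \<Rightarrow> complex"
  by (simp add: eval_nat_numeral)

text \<open>The k-th derivative of x^(-s) contributes (-1)^k (s)_k. Measuring s from 1 - A_0 makes
  all three quartics even about a centre. The first is the indicial polynomial, with roots A_2,
  -A_2, A_3, -A_3; the other two are centred at \<nu> = -1/2 and \<nu> = -1.\<close>

lemma indicial:
  fixes s :: complex
  assumes "s = 1 - A $ 0 + \<nu>"
  shows "(\<Sum>k\<le>4. top_coeff A k * ((- 1) ^ k * pochhammer s k)) = lead A \<nu>"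
    and "(\<Sum>k\<le>4. mid_coeff A k * ((- 1) ^ k * pochhammer s k)) = mid A (\<nu> + 1 / 2)"
    and "(\<Sum>k\<le>4. low_coeff A k * ((- 1) ^ k * pochhammer s k)) = low A (\<nu> + 1)"
  unfolding sum_upto_4 pochhammer_numerals top_coeff_def mid_coeff_def low_coeff_def lead_def mid_def low_def assms
  by simp_all algebra+

lemma sums_shift_power:
  fixes f :: "nat \<Rightarrow> complex"
  assumes "(\<lambda>n. f n * y ^ n) sums s"
  shows "(\<lambda>n. (if n < k then 0 else f (n - k)) * y ^ n) sums (y ^ k * s)"
proof -
  have "(\<lambda>n. y ^ k * (f n * y ^ n)) sums (y ^ k * s)"
    using assms by (rule sums_mult)
  then have "(\<lambda>n. (if n + k < k then 0 else f (n + k - k)) * y ^ (n + k)) sums (y ^ k * s)"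
    by (simp add: power_add mult_ac)
  then show ?thesis
    by (subst (asm) sums_iff_shift) (simp add: sum.neutral)
qed

text \<open>The prefactor (1/x)^\<rho> x has no zero off the slit, so the equation at x is
  equivalent to s = 0. This makes the lemma usable in both directions.\<close>

lemma Z_frobenius_inf:
  assumes "norm (1 / x) < conv_radius C" "x \<notin> \<real>\<^sub>\<le>\<^sub>0"
  obtains s where "(\<lambda>n. frob_res A C n * (1 / x) ^ n) sums s"
    "Z A (frobenius_inf (rho_A2 A) C) x = (1 / x) powr rho_A2 A * x * s"
proof -
  define y where "y = 1 / x"
  define \<rho> where "\<rho> = rho_A2 A"
  have x: "x \<noteq> 0" using assms(2) by auto
  have y: "y \<noteq> 0" "x * y = 1" using x by (auto simp: y_def)
  define D where "D k n = (- 1) ^ k * pochhammer (\<rho> + of_nat n) k" for k and n :: nat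
  define d where "d k = (\<Sum>n. D k n * C n * y ^ n)" for k
  have deriv: "(deriv ^^ k) (frobenius_inf \<rho> C) x = y powr \<rho> * y ^ k * d k" for k
    using funpow_deriv_frobenius_inf(1)[where k = k and \<rho> = \<rho>, OF assms] y
    by (simp add: frobenius_inf_def y_def[symmetric] D_def d_def powr_add powr_nat')
  have sums: "(\<lambda>n. D k n * C n * y ^ n) sums d k" for k
    unfolding d_def D_def y_def
    using assms(1) funpow_deriv_frobenius_inf(2)[where k = k and \<rho> = \<rho>, OF assms]
    by (intro summable_sums summable_in_conv_radius) (rule less_le_trans)
  have comb: "(\<lambda>n. (\<Sum>k\<le>4. e k * D k n) * C n * y ^ n) sums (\<Sum>k\<le>4. e k * d k)" for e :: "nat \<Rightarrow> complex"
    using sums_sum[of "{..4}" "\<lambda>k n. e k * (D k n * C n * y ^ n)" "\<lambda>k. e k * d k"] sums_mult[OF sums]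
    by (simp add: sum_distrib_right mult.assoc)
  have ind: "\<rho> + of_nat n = 1 - A $ 0 + (of_nat n + A $ 2)" for n
    by (simp add: \<rho>_def rho_A2_def)
  define l where "l = (\<Sum>k\<le>4. top_coeff A k * d k)"
  define m where "m = (\<Sum>k\<le>4. mid_coeff A k * d k)"
  define h where "h = (\<Sum>k\<le>4. low_coeff A k * d k)"
  have l: "(\<lambda>n. lead A (of_nat n + A $ 2) * C n * y ^ n) sums l"
    using comb[of "top_coeff A"] unfolding l_def D_def indicial[OF ind] .
  have "(\<lambda>n. mid A (of_nat n + A $ 2 + 1 / 2) * C n * y ^ n) sums m"
    using comb[of "mid_coeff A"] unfolding m_def D_def indicial[OF ind] .
  from sums_shift_power[OF this, of 1]
  have m: "(\<lambda>n. (if n < 1 then 0 else mid A (of_nat (n - 1) + A $ 2 + 1 / 2) * C (n - 1)) * y ^ n) sums (y * m)"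
    by simp
  have "(\<lambda>n. low A (of_nat n + A $ 2 + 1) * C n * y ^ n) sums h"
    using comb[of "low_coeff A"] unfolding h_def D_def indicial[OF ind] .
  from sums_shift_power[OF this, of 2]
  have h: "(\<lambda>n. (if n < 2 then 0 else low A (of_nat (n - 2) + A $ 2 + 1) * C (n - 2)) * y ^ n) sums (y\<^sup>2 * h)" .
  have "frob_res A C n * y ^ n = lead A (of_nat n + A $ 2) * C n * y ^ n
      + (if n < 1 then 0 else mid A (of_nat (n - 1) + A $ 2 + 1 / 2) * C (n - 1)) * y ^ n
      + (if n < 2 then 0 else low A (of_nat (n - 2) + A $ 2 + 1) * C (n - 2)) * y ^ n" for n
  proof -
    have mid: "(if n < 1 then 0 else mid A (of_nat (n - 1) + A $ 2 + 1 / 2) * C (n - 1)) =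
        (if n = 0 then 0 else mid A (of_nat n - 1 / 2 + A $ 2) * C (n - 1))"
    proof (cases "n = 0")
      case False
      then have eq: "of_nat (n - 1) + A $ 2 + 1 / 2 = of_nat n - 1 / 2 + A $ 2"
        by (simp add: of_nat_diff field_simps)
      show ?thesis unfolding eq by simp
    qed simp
    have low: "(if n < 2 then 0 else low A (of_nat (n - 2) + A $ 2 + 1) * C (n - 2)) =
        (if n < 2 then 0 else low A (of_nat n - 1 + A $ 2) * C (n - 2))"
    proof (cases "n < 2")
      case False
      then have eq: "of_nat (n - 2) + A $ 2 + 1 = of_nat n - 1 + A $ 2"
        by (simp add: of_nat_diff field_simps)
      show ?thesis unfolding eq by simp
    qed simp
    show ?thesis
      unfolding frob_res_def mid low by (simp only: distrib_right)
  qed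
  then have "(\<lambda>n. frob_res A C n * y ^ n) sums (l + y * m + y\<^sup>2 * h)"
    using sums_add[OF sums_add[OF l m] h] by simp
  moreover have "Z A (frobenius_inf \<rho> C) x = y powr \<rho> * x * (l + y * m + y\<^sup>2 * h)"
  proof -
    \<comment> \<open>From here on x y = 1 is the only relation used to compare the operator with
      the three coefficient lists.\<close>
    let ?c = "\<lambda>k. x * (top_coeff A k + y * mid_coeff A k + y\<^sup>2 * low_coeff A k)"
    have c: "p0 A x * y ^ 4 = ?c 4" "p1 A x * y ^ 3 = ?c 3" "p2 A x * y\<^sup>2 = ?c 2"
        "p3 A x * y = ?c 1" "p4 A x = ?c 0"
      using y(2) unfolding p0_def p1_def p2_def p3_def p4_def top_coeff_def mid_coeff_def low_coeff_def
      by (simp, algebra)+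
    have "Z A (frobenius_inf \<rho> C) x = p0 A x * (y powr \<rho> * y ^ 4 * d 4) + p1 A x * (y powr \<rho> * y ^ 3 * d 3)
        + p2 A x * (y powr \<rho> * y\<^sup>2 * d 2) + p3 A x * (y powr \<rho> * y * d 1) + p4 A x * (y powr \<rho> * d 0)"
      using deriv[of 1] deriv[of 0] by (simp add: Z_def deriv)
    also have "\<dots> = y powr \<rho> * (p0 A x * y ^ 4 * d 4 + p1 A x * y ^ 3 * d 3
        + p2 A x * y\<^sup>2 * d 2 + p3 A x * y * d 1 + p4 A x * d 0)"
      by (simp only: distrib_left mult_ac)
    also have "\<dots> = y powr \<rho> * (?c 4 * d 4 + ?c 3 * d 3 + ?c 2 * d 2 + ?c 1 * d 1 + ?c 0 * d 0)"
      unfolding c ..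
    also have "\<dots> = y powr \<rho> * x * (l + y * m + y\<^sup>2 * h)"
      unfolding l_def m_def h_def sum_upto_4 by (simp add: algebra_simps)
    finally show ?thesis .
  qed
  ultimately show ?thesis
    using that by (simp add: y_def \<rho>_def)
qed

section \<open>Generic parameters\<close>

text \<open>One condition for all resonances: every number that must not vanish below is, after
  multiplication by 1 or 2, an integer affine form in A with some nonzero coefficient, or else a
  nonzero integer.\<close>

definition int_independent :: "complex ^ 4 \<Rightarrow> bool" where
  "int_independent A \<longleftrightarrow> (\<forall>c0 c1 c2 c3 m :: int.
     of_int c0 * A $ 0 + of_int c1 * A $ 1 + of_int c2 * A $ 2 + of_int c3 * A $ 3 = of_int m
     \<longrightarrow> c0 = 0 \<and> c1 = 0 \<and> c2 = 0 \<and> c3 = 0)"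

text \<open>The multiplier \<open>k\<close> clears denominators: k = 2 is used for the half in
  \<open>Aeps\<close>. A nonzero coefficient then refutes x = 0.\<close>

lemma int_independentD:
  fixes x :: complex
  assumes "int_independent A" "x = 0"
    and "of_int k * x = of_int c0 * A $ 0 + of_int c1 * A $ 1 + of_int c2 * A $ 2 + of_int c3 * A $ 3 - of_int m"
  shows "c0 = 0 \<and> c1 = 0 \<and> c2 = 0 \<and> c3 = 0"
proof -
  have "of_int c0 * A $ 0 + of_int c1 * A $ 1 + of_int c2 * A $ 2 + of_int c3 * A $ 3 = of_int m"
    using assms(2,3) by simp
  then show ?thesis
    using assms(1) unfolding int_independent_def by blast
qed

lemma algebraic_hypersurface_affine:
  fixes c :: "4 \<Rightarrow> complex"
  assumes "c j \<noteq> 0"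
  shows "algebraic_hypersurface {A :: complex ^ 4. c 0 * A $ 0 + c 1 * A $ 1 + c 2 * A $ 2 + c 3 * A $ 3 + d = 0}"
proof -
  define p where "p = (\<lambda>A :: complex ^ 4. c 0 * A $ 0 + c 1 * A $ 1 + c 2 * A $ 2 + c 3 * A $ 3 + d)"
  have "polynomial_fun p"
    unfolding p_def
    by (rule polynomial_fun.add polynomial_fun.mult polynomial_fun.coord polynomial_fun.const)+
  \<comment> \<open>The two values differ by c_j, so the affine form is not constant.\<close>
  moreover have "p (axis j 1) \<noteq> p 0"
  proof -
    have "j = 0 \<or> j = 1 \<or> j = 2 \<or> j = 3"
      using exhaust_4[of j] by force
    then show ?thesis
      using assms by (elim disjE) (simp_all add: p_def axis_def)
  qed
  ultimately show ?thesis
    unfolding algebraic_hypersurface_def by (intro exI[of _ p] conjI exI[of _ "axis j 1"] exI[of _ 0]) (simp_all add: p_def)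
qed

lemma for_generic_int_independent: "for_generic int_independent"
proof -
  define H :: "(4 \<Rightarrow> int) \<times> int \<Rightarrow> (complex ^ 4) set" where
    "H = (\<lambda>(c, m). {A. of_int (c 0) * A $ 0 + of_int (c 1) * A $ 1 + of_int (c 2) * A $ 2
       + of_int (c 3) * A $ 3 + of_int (- m) = 0})"
  define \<H> where "\<H> = H ` {(c, m). \<exists>j. c j \<noteq> 0}"
  have "countable \<H>"
    unfolding \<H>_def by (rule countable_image) (rule countableI_type)
  moreover have "algebraic_hypersurface S" if "S \<in> \<H>" for S
  proof -
    obtain c m j where "S = H (c, m)" "c j \<noteq> 0"
      using \<open>S \<in> \<H>\<close> unfolding \<H>_def by blast
    then show ?thesis
      using algebraic_hypersurface_affine[of "\<lambda>j. of_int (c j)" j "of_int (- m)"] by (simp add: H_def)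
  qed
  moreover have "int_independent A" if A: "A \<notin> \<Union>\<H>" for A
    unfolding int_independent_def
  proof (intro allI impI)
    fix c0 c1 c2 c3 m :: int
    assume eq: "of_int c0 * A $ 0 + of_int c1 * A $ 1 + of_int c2 * A $ 2 + of_int c3 * A $ 3 = of_int m"
    \<comment> \<open>Packs the four integers into a function on the index type; index 3 receives
      the default value.\<close>
    define c :: "4 \<Rightarrow> int" where "c = (\<lambda>_. c3)(0 := c0, 1 := c1, 2 := c2)"
    have c: "c 0 = c0" "c 1 = c1" "c 2 = c2" "c 3 = c3"
      by (simp_all add: c_def)
    have "A \<in> H (c, m)"
      using eq by (simp add: H_def c)
    then have "\<forall>j. c j = 0"
      using A unfolding \<H>_def by blast
    then show "c0 = 0 \<and> c1 = 0 \<and> c2 = 0 \<and> c3 = 0"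
      using c by metis
  qed
  ultimately show ?thesis
    unfolding for_generic_def by (intro exI[of _ \<H>]) simp
qed

lemma for_generic_mono:
  assumes "for_generic P" "\<And>A. P A \<Longrightarrow> Q A"
  shows "for_generic Q"
proof -
  obtain \<H> where "countable \<H>" "\<forall>H\<in>\<H>. algebraic_hypersurface H" "\<forall>A. A \<notin> \<Union>\<H> \<longrightarrow> P A"
    using assms(1) unfolding for_generic_def by (elim exE conjE)
  with assms(2) show ?thesis
    unfolding for_generic_def by (intro exI[of _ \<H>]) simp
qed

context
  fixes A :: "complex ^ 4"
  assumes indep: "int_independent A"
begin

lemma nonzero_A2: "2 * A $ 2 + of_int k \<noteq> 0"
  using int_independentD[OF indep, of "2 * A $ 2 + of_int k" 1 0 0 2 0 "- k"] by auto

lemma nonzero_A0_A2: "A $ 2 + A $ 0 + of_int k \<noteq> 0" "A $ 2 - A $ 0 + of_int k \<noteq> 0"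
proof -
  show "A $ 2 + A $ 0 + of_int k \<noteq> 0"
    using int_independentD[OF indep, of _ 1 1 0 1 0 "- k"] by (auto simp: add_ac)
  show "A $ 2 - A $ 0 + of_int k \<noteq> 0"
    using int_independentD[OF indep, of _ 1 "-1" 0 1 0 "- k"] by (auto simp: algebra_simps)
qed

lemma nonzero_A3_A2: "A $ 2 + A $ 3 + of_int k \<noteq> 0" "A $ 2 - A $ 3 + of_int k \<noteq> 0"
proof -
  show "A $ 2 + A $ 3 + of_int k \<noteq> 0"
    using int_independentD[OF indep, of _ 1 0 0 1 1 "- k"] by (auto simp: add_ac)
  show "A $ 2 - A $ 3 + of_int k \<noteq> 0"
    using int_independentD[OF indep, of _ 1 0 0 1 "-1" "- k"] by (auto simp: algebra_simps)
qed

lemma nonzero_Aeps: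
  assumes "e0 \<in> {1, -1}" "e1 \<in> {1, -1}" "e2 \<in> {1, -1}" "e3 \<in> {1, -1}"
  shows "Aeps A e0 e1 e2 e3 + of_int k \<noteq> 0"
proof
  assume z: "Aeps A e0 e1 e2 e3 + of_int k = 0"
  \<comment> \<open>Reads a complex sign as an integer, because the coefficients of the relation
    must be integers.\<close>
  define s where "s e = (if e = (1 :: complex) then 1 else -1 :: int)" for e
  have s: "of_int (s e) = e" "s e \<noteq> 0" if "e \<in> {1, -1}" for e :: complex
    using that by (auto simp: s_def)
  show False
    using int_independentD[OF indep z, of 2 "s e0" "s e1" "s e2" "s e3" "- 2 * k - 1"] s(2)[OF assms(1)]
    by (simp add: s(1)[OF assms(1)] s(1)[OF assms(2)] s(1)[OF assms(3)] s(1)[OF assms(4)] Aeps_def field_simps)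
qed

text \<open>Nonresonance: for n > 0 no \<rho> + n is again a local exponent, so the recurrence can
  be solved for \<open>C n\<close>.\<close>

lemma lead_neq_0:
  assumes "n > 0"
  shows "lead A (of_nat n + A $ 2) \<noteq> 0"
proof -
  have "lead A (of_nat n + A $ 2) = of_nat n * (2 * A $ 2 + of_nat n) * (A $ 2 + A $ 3 + of_nat n) * (A $ 2 - A $ 3 + of_nat n)"
    unfolding lead_def by algebra
  then show ?thesis
    using assms nonzero_A2[of "int n"] nonzero_A3_A2[of "int n"] by simp
qed

lemma frob_rec_unique:
  assumes "frob_rec A C" "frob_rec A D"
  shows "C = D"
proof
  fix n
  show "C n = D n"
  proof (induction n rule: less_induct)
    case (less n)
    show ?case
    proof (cases "n = 0")
      case True
      with assms show ?thesis by (simp add: frob_rec_def)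
    next
      case False
      have "C (n - 1) = D (n - 1)" "n \<ge> 2 \<Longrightarrow> C (n - 2) = D (n - 2)"
        using less False by simp_all
      then have "frob_res A C n - frob_res A D n = lead A (of_nat n + A $ 2) * (C n - D n)"
        unfolding frob_res_def by (auto simp: algebra_simps)
      moreover have "frob_res A C n = 0" "frob_res A D n = 0"
        using assms by (simp_all add: frob_rec_def)
      ultimately show ?thesis
        using lead_neq_0[of n] False by simp
    qed
  qed
qed

end

section \<open>Convergence\<close>

lemma ratio_tendsto_1: "(\<lambda>n. (a + of_nat n) / (b + of_nat n) :: complex) \<longlonglongrightarrow> 1"
proof -
  have "(\<lambda>n. a / of_nat n + 1 :: complex) \<longlonglongrightarrow> 0 + 1" "(\<lambda>n. b / of_nat n + 1 :: complex) \<longlonglongrightarrow> 0 + 1"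
    by (intro tendsto_add tendsto_const lim_const_over_n)+
  then have "(\<lambda>n. (a / of_nat n + 1) / (b / of_nat n + 1) :: complex) \<longlonglongrightarrow> (0 + 1) / (0 + 1)"
    by (intro tendsto_divide) simp_all
  moreover have "eventually (\<lambda>n. (a / of_nat n + 1) / (b / of_nat n + 1) = (a + of_nat n) / (b + of_nat n)) sequentially"
    using eventually_gt_at_top[of 0] by eventually_elim (simp add: divide_simps)
  ultimately show ?thesis
    by (simp add: tendsto_cong)
qed

lemma conv_radius_pochhammer_ratio:
  assumes "\<And>k. a + of_nat k \<noteq> 0" "\<And>k. b + of_nat k \<noteq> 0" "\<And>k. c + of_nat k \<noteq> 0" "\<And>k. d + of_nat k \<noteq> 0"
  shows "conv_radius (\<lambda>n. pochhammer a n * pochhammer b n / (pochhammer c n * pochhammer d n) :: complex) = 1"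
    (is "conv_radius ?f = 1")
proof (rule conv_radius_ratio_limit_nonzero[where c = 1])
  have "(\<lambda>n. norm ((c + of_nat n) / (a + of_nat n) * ((d + of_nat n) / (b + of_nat n)))) \<longlonglongrightarrow> norm (1 * 1 :: complex)"
    by (intro tendsto_norm tendsto_mult ratio_tendsto_1)
  moreover have "norm ((c + of_nat n) / (a + of_nat n) * ((d + of_nat n) / (b + of_nat n))) = norm (?f n) / norm (?f (Suc n))" for n
    using assms[THEN pochhammer_neq_0, of n] assms[of n] unfolding norm_divide[symmetric]
    by (intro arg_cong[where f = norm]) (simp add: pochhammer_Suc divide_simps)
  ultimately show "(\<lambda>n. norm (?f n) / norm (?f (Suc n))) \<longlonglongrightarrow> 1"
    by simp
qed simp_all

text \<open>With q = sqrt r one has r^n = q^n q^n and q < 1. At q one series converges absolutely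
  and the terms of the other are bounded. It is applied to products of Pochhammer quotients and of a
  gauge factor with a convolution.\<close>

lemma conv_radius_hadamard:
  fixes f g :: "nat \<Rightarrow> complex"
  assumes "conv_radius f \<ge> 1" "conv_radius g \<ge> 1"
  shows "conv_radius (\<lambda>n. f n * g n) \<ge> 1"
proof (rule conv_radius_geI_ex')
  fix r :: real assume r: "0 < r" "ereal r < 1"
  define q where "q = sqrt r"
  have q: "0 < q" "q < 1" "q * q = r"
  proof -
    have "r < 1"
      using r(2) by simp
    then show "0 < q" "q < 1" "q * q = r"
      using r(1) by (simp_all add: q_def)
  qed
  have q1: "ereal (norm (of_real q :: complex)) < 1"
    using q by simp
  have lt: "ereal (norm (of_real q :: complex)) < conv_radius f" "ereal (norm (of_real q :: complex)) < conv_radius g"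
    using less_le_trans[OF q1 assms(1)] less_le_trans[OF q1 assms(2)] by simp_all
  have "summable (\<lambda>n. norm (f n * of_real q ^ n))"
    by (intro abs_summable_in_conv_radius lt)
  moreover have "summable (\<lambda>n. norm (g n * of_real q ^ n))"
    by (intro abs_summable_in_conv_radius lt)
  then have "(\<lambda>n. g n * of_real q ^ n) \<longlonglongrightarrow> 0"
    by (intro summable_LIMSEQ_zero) (rule summable_norm_cancel)
  then have "Bseq (\<lambda>n. g n * of_real q ^ n)"
    by (intro convergent_imp_Bseq convergentI)
  then obtain K where K: "\<And>n. norm (g n * of_real q ^ n) \<le> K"
    unfolding Bseq_def by blast
  ultimately have "summable (\<lambda>n. norm (f n * of_real q ^ n) * K)"
    by (intro summable_mult2)
  then have "summable (\<lambda>n. norm (f n * of_real q ^ n) * norm (g n * of_real q ^ n))"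
  proof (rule summable_comparison_test'[where N = 0])
    fix n
    show "norm (norm (f n * of_real q ^ n) * norm (g n * of_real q ^ n)) \<le> norm (f n * of_real q ^ n) * K"
      unfolding real_norm_def abs_mult abs_norm_cancel by (intro mult_left_mono K norm_ge_zero)
  qed
  moreover have "norm (f n * of_real q ^ n) * norm (g n * of_real q ^ n) = norm (f n * g n * of_real r ^ n)" for n
    unfolding q(3)[symmetric] norm_mult[symmetric] of_real_mult power_mult_distrib by (simp only: mult_ac)
  ultimately have "summable (\<lambda>n. norm (f n * g n * of_real r ^ n))"
    by (simp only:)
  then show "summable (\<lambda>n. f n * g n * of_real r ^ n)"
    by (rule summable_norm_cancel)
qed

lemma conv_radius_hyp_coeff:
  assumes "\<And>k. a + of_nat k \<noteq> 0" "\<And>k. b + of_nat k \<noteq> 0" "\<And>k. e + of_nat k \<noteq> 0"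
  shows "conv_radius (hyp_coeff a b e) = 1"
proof -
  have one: "(1 :: complex) + of_nat k \<noteq> 0" for k
    using of_nat_neq_0[of k] by simp
  show ?thesis
    using conv_radius_pochhammer_ratio[OF assms(1,2) one assms(3)]
    by (simp add: hyp_coeff_def[abs_def] pochhammer_fact)
qed

section \<open>Normalized solutions and the recurrence\<close>

text \<open>Summability at a single point already gives a positive radius. On large positive x,
  which avoid the slit, the equation makes the series of residues vanish at all small positive y.
  These points accumulate at 0, so every residue is zero.\<close>

lemma normalized_imp_frob_rec:
  assumes "normalized_solution_inf A (rho_A2 A) C"
  shows "frob_rec A C"
proof -
  have C0: "C 0 = 1"
    using assms by (simp add: normalized_solution_inf_def)
  obtain b where b: "\<And>x. norm x \<ge> b \<Longrightarrow> x \<notin> \<real>\<^sub>\<le>\<^sub>0 \<Longrightarrow>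
      summable (\<lambda>n. C n * (1 / x) ^ n) \<and> Z A (frobenius_inf (rho_A2 A) C) x = 0"
    using assms unfolding normalized_solution_inf_def eventually_at_infinity by metis
  define R where "R = max b 1"
  have R: "R > 0" "R \<ge> b"
    by (simp_all add: R_def)
  have pos: "of_real r \<notin> (\<real>\<^sub>\<le>\<^sub>0 :: complex set)" if "r > 0" for r
    using that by simp
  have "summable (\<lambda>n. C n * (1 / of_real R) ^ n)"
    using b[of "of_real R"] R pos[of R] by simp
  then have radius: "ereal (1 / R) \<le> conv_radius C"
    using conv_radius_geI[of C "1 / of_real R"] R by (simp add: norm_divide)
  have sums: "(\<lambda>n. frob_res A C n * of_real r ^ n) sums 0" if r: "0 < r" "r < 1 / R" for r
  proof -
    have "R \<le> 1 / r"
      using r R by (simp add: field_simps)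
    have "ereal (norm (1 / of_real (1 / r) :: complex)) < ereal (1 / R)"
      using r by simp
    then have "norm (1 / of_real (1 / r) :: complex) < conv_radius C"
      using radius by (rule less_le_trans)
    moreover have "of_real (1 / r) \<notin> (\<real>\<^sub>\<le>\<^sub>0 :: complex set)"
      using r by (intro pos) simp
    ultimately obtain s where s: "(\<lambda>n. frob_res A C n * (1 / of_real (1 / r)) ^ n) sums s"
      "Z A (frobenius_inf (rho_A2 A) C) (of_real (1 / r)) = (1 / of_real (1 / r)) powr rho_A2 A * of_real (1 / r) * s"
      by (rule Z_frobenius_inf)
    moreover have "Z A (frobenius_inf (rho_A2 A) C) (of_real (1 / r)) = 0"
      using b[of "of_real (1 / r)"] pos[of "1 / r"] \<open>R \<le> 1 / r\<close> R r by (simp add: norm_divide)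
    ultimately show ?thesis
      using r by simp
  qed
  have "frob_res A C n = 0" for n
  proof (rule ccontr)
    assume n: "frob_res A C n \<noteq> 0"
    \<comment> \<open>The constant term vanishes for every \<open>C\<close>, because A_2 is a root
      of \<open>lead\<close>. The theorem on isolated zeros at 0 therefore applies, with n >
      0.\<close>
    have res0: "frob_res A C 0 = 0"
      by (simp add: frob_res_def lead_def)
    with n have "n > 0"
      by (intro gr0I) simp
    define q where "q = 1 / R / 2"
    have q: "0 < q" "q < 1 / R"
      using R by (simp_all add: q_def field_simps)
    have "ereal (norm (of_real q :: complex)) \<le> conv_radius (frob_res A C)"
      by (rule conv_radius_geI) (rule sums_summable[OF sums[OF q]])
    then have q_le: "ereal q \<le> conv_radius (frob_res A C)"
      using q by simp
    have powser: "(\<lambda>n. frob_res A C n * (x - 0) ^ n) sums (\<Sum>n. frob_res A C n * x ^ n)" if "norm (x - 0) < q" for x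
    proof -
      have "ereal (norm x) < conv_radius (frob_res A C)"
        using that q_le by (simp add: less_le_trans[of _ "ereal q"])
      then show ?thesis
        by (simp add: summable_sums summable_in_conv_radius)
    qed
    have at_0: "(\<Sum>n. frob_res A C n * 0 ^ n) = 0"
      using res0 by simp
    have "\<exists>s>0. \<forall>z \<in> cball 0 s - {0}. (\<Sum>n. frob_res A C n * z ^ n) \<noteq> 0"
      by (rule powser_0_nonzero[OF q(1) powser at_0 n \<open>n > 0\<close>]) (assumption, blast)
    then obtain s where s: "0 < s" "\<And>z. z \<in> cball 0 s - {0} \<Longrightarrow> (\<Sum>n. frob_res A C n * z ^ n) \<noteq> 0"
      by blast
    define r where "r = min s q"
    have r: "0 < r" "r \<le> s" "r < 1 / R"
      using s(1) q by (auto simp: r_def min_less_iff_disj)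
    have "(\<Sum>n. frob_res A C n * of_real r ^ n) = 0"
      using sums[OF r(1,3)] by (simp add: sums_iff)
    with s(2)[of "of_real r"] r show False
      by simp
  qed
  with C0 show ?thesis
    by (simp add: frob_rec_def)
qed

lemma frob_rec_imp_normalized:
  assumes "frob_rec A C" "conv_radius C \<ge> 1"
  shows "normalized_solution_inf A (rho_A2 A) C"
proof -
  have "summable (\<lambda>n. C n * (1 / x) ^ n) \<and> Z A (frobenius_inf (rho_A2 A) C) x = 0"
    if x: "norm x \<ge> 2" "x \<notin> \<real>\<^sub>\<le>\<^sub>0" for x
  proof -
    have "ereal (norm (1 / x)) < 1"
      using x(1) by (simp add: norm_divide divide_less_eq)
    then have lt: "norm (1 / x) < conv_radius C"
      using assms(2) by (rule less_le_trans)
    obtain s where s: "(\<lambda>n. frob_res A C n * (1 / x) ^ n) sums s"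
      "Z A (frobenius_inf (rho_A2 A) C) x = (1 / x) powr rho_A2 A * x * s"
      using Z_frobenius_inf[OF lt x(2)] by metis
    have "s = 0"
      using assms(1) sums_unique2[OF s(1)] by (simp add: frob_rec_def)
    with s(2) lt show ?thesis
      by (simp add: summable_in_conv_radius)
  qed
  then show ?thesis
    using assms(1) unfolding normalized_solution_inf_def eventually_at_infinity frob_rec_def by blast
qed

lemma normalized_iff:
  assumes "int_independent A" "frob_rec A C" "conv_radius C \<ge> 1"
  shows "normalized_solution_inf A (rho_A2 A) D \<longleftrightarrow> D = C"
  using frob_rec_imp_normalized[OF assms(2,3)] normalized_imp_frob_rec[of A D]
    frob_rec_unique[OF assms(1), of D C] assms(2) by blast

section \<open>The three coefficient formulas\<close>

text \<open>
  Formulas I, II and III use the gauge with \<open>p = 0\<close>, \<open>p = A\<^sub>0\<close> and \<open>p = A\<^sub>3\<close>; accordingly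
  \<open>{p, w + z, w - z}\<close> below is \<open>{0, A\<^sub>0, A\<^sub>3}\<close>.
\<close>

definition gauge :: "complex ^ 4 \<Rightarrow> complex \<Rightarrow> nat \<Rightarrow> complex" where
  "gauge A p n = pochhammer (1 / 2 + A $ 2) n * pochhammer (1 + A $ 2 - p) n * pochhammer (1 + A $ 2 + p) n
     / (pochhammer (1 + A $ 2) n * pochhammer (1 + A $ 2 - A $ 3) n * pochhammer (1 + A $ 2 + A $ 3) n)"

text \<open>Passing from S to g S trades the factor N^2 - p^2 of the leading coefficient for N^2 -
  s^2 and gives the middle one a second factor N - 1/2. The common factor N (N - 1) is then
  cancelled. \<open>X\<close> and \<open>Y\<close> hold the lowest terms before and after.\<close>

lemma gauge_step:
  fixes N \<mu> p s \<kappa> g1 g2 S1 S2 X Y :: complex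
  assumes S: "(N - 1) * ((N\<^sup>2 - \<mu>\<^sup>2) * (N\<^sup>2 - p\<^sup>2)) * S2 + N * (N - 1) * (N - 1 / 2) * (\<kappa> - 2 * (N - 1 / 2)\<^sup>2) * S1 + X = 0"
    and g2: "N * (N\<^sup>2 - s\<^sup>2) * g2 = (N - 1 / 2) * (N\<^sup>2 - p\<^sup>2) * g1"
    and Y: "N * (N - 1) * Y = (N - 1 / 2) * g1 * X"
    and nz: "N \<noteq> 0" "N - 1 \<noteq> 0"
  shows "(N\<^sup>2 - \<mu>\<^sup>2) * (N\<^sup>2 - s\<^sup>2) * (g2 * S2) + (N - 1 / 2)\<^sup>2 * (\<kappa> - 2 * (N - 1 / 2)\<^sup>2) * (g1 * S1) + Y = 0"
    (is "?r = 0")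
proof -
  have "N * (N - 1) * ?r = (N - 1) * (N\<^sup>2 - \<mu>\<^sup>2) * S2 * (N * (N\<^sup>2 - s\<^sup>2) * g2)
      + N * (N - 1) * (N - 1 / 2)\<^sup>2 * (\<kappa> - 2 * (N - 1 / 2)\<^sup>2) * (g1 * S1) + N * (N - 1) * Y"
    by algebra
  also have "\<dots> = (N - 1 / 2) * g1 * ((N - 1) * ((N\<^sup>2 - \<mu>\<^sup>2) * (N\<^sup>2 - p\<^sup>2)) * S2
      + N * (N - 1) * (N - 1 / 2) * (\<kappa> - 2 * (N - 1 / 2)\<^sup>2) * S1 + X)"
    unfolding g2 Y by algebra
  finally show ?thesis
    using nz unfolding S by simp
qed

context
  fixes A :: "complex ^ 4"
  assumes indep: "int_independent A"
begin

lemma nonzero_nat: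
  "A $ 2 + 1 + of_nat k \<noteq> 0" "A $ 2 + of_nat k \<noteq> 0" "1 + A $ 2 + of_nat k \<noteq> 0" "1 / 2 + A $ 2 + of_nat k \<noteq> 0"
  "1 + A $ 2 + A $ 3 + of_nat k \<noteq> 0" "1 + A $ 2 - A $ 3 + of_nat k \<noteq> 0"
  "1 + A $ 2 + A $ 0 + of_nat k \<noteq> 0" "1 + A $ 2 - A $ 0 + of_nat k \<noteq> 0"
proof -
  have "2 * A $ 2 + of_int (2 * int k + 2) = 2 * (A $ 2 + 1 + of_nat k)"
    by (simp add: field_simps)
  with nonzero_A2[OF indep, of "2 * int k + 2"] show "A $ 2 + 1 + of_nat k \<noteq> 0"
    by (metis mult_zero_right)
  have "2 * A $ 2 + of_int (2 * int k + 0) = 2 * (A $ 2 + of_nat k)"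
    by (simp add: field_simps)
  with nonzero_A2[OF indep, of "2 * int k + 0"] show "A $ 2 + of_nat k \<noteq> 0"
    by (metis mult_zero_right)
  have "2 * A $ 2 + of_int (2 * int k + 2) = 2 * (1 + A $ 2 + of_nat k)"
    by (simp add: field_simps)
  with nonzero_A2[OF indep, of "2 * int k + 2"] show "1 + A $ 2 + of_nat k \<noteq> 0"
    by (metis mult_zero_right)
  have "2 * A $ 2 + of_int (2 * int k + 1) = 2 * (1 / 2 + A $ 2 + of_nat k)"
    by (simp add: field_simps)
  with nonzero_A2[OF indep, of "2 * int k + 1"] show "1 / 2 + A $ 2 + of_nat k \<noteq> 0"
    by (metis mult_zero_right)
  have "A $ 2 + A $ 3 + of_int (int k + 1) = 1 + A $ 2 + A $ 3 + of_nat k"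
    by simp
  with nonzero_A3_A2(1)[OF indep, of "int k + 1"] show "1 + A $ 2 + A $ 3 + of_nat k \<noteq> 0"
    by metis
  have "A $ 2 - A $ 3 + of_int (int k + 1) = 1 + A $ 2 - A $ 3 + of_nat k"
    by simp
  with nonzero_A3_A2(2)[OF indep, of "int k + 1"] show "1 + A $ 2 - A $ 3 + of_nat k \<noteq> 0"
    by metis
  have "A $ 2 + A $ 0 + of_int (int k + 1) = 1 + A $ 2 + A $ 0 + of_nat k"
    by simp
  with nonzero_A0_A2(1)[OF indep, of "int k + 1"] show "1 + A $ 2 + A $ 0 + of_nat k \<noteq> 0"
    by metis
  have "A $ 2 - A $ 0 + of_int (int k + 1) = 1 + A $ 2 - A $ 0 + of_nat k"
    by simp
  with nonzero_A0_A2(2)[OF indep, of "int k + 1"] show "1 + A $ 2 - A $ 0 + of_nat k \<noteq> 0"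
    by metis
qed

lemma nonzero_Aeps_nat:
  assumes "e0 \<in> {1, -1}" "e1 \<in> {1, -1}" "e2 \<in> {1, -1}" "e3 \<in> {1, -1}"
  shows "Aeps A e0 e1 e2 e3 + of_nat k \<noteq> 0"
  using nonzero_Aeps[OF indep assms, of "int k"] by simp

lemma gauge_Suc:
  fixes n p
  defines "N \<equiv> of_nat n + 1 + A $ 2"
  shows "N * (N\<^sup>2 - (A $ 3)\<^sup>2) * gauge A p (Suc n) = (N - 1 / 2) * (N\<^sup>2 - p\<^sup>2) * gauge A p n"
proof -
  have nz: "pochhammer (1 + A $ 2) n \<noteq> 0" "pochhammer (1 + A $ 2 - A $ 3) n \<noteq> 0" "pochhammer (1 + A $ 2 + A $ 3) n \<noteq> 0"
    by (intro pochhammer_neq_0 nonzero_nat)+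
  have N: "1 / 2 + A $ 2 + of_nat n = N - 1 / 2" "1 + A $ 2 + of_nat n = N"
      "1 + A $ 2 - x + of_nat n = N - x" "1 + A $ 2 + x + of_nat n = N + x" for x
    by (simp_all add: N_def)
  moreover have "N \<noteq> 0" "N + A $ 3 \<noteq> 0" "N - A $ 3 \<noteq> 0"
    using nonzero_nat(3,5,6)[of n] unfolding N .
  moreover have sq: "N\<^sup>2 - x\<^sup>2 = (N - x) * (N + x)" for x
    by (simp add: algebra_simps power2_eq_square)
  ultimately show ?thesis
    using nz unfolding gauge_def pochhammer_Suc N sq by (simp add: divide_simps)
qed

lemma conv_radius_gauge:
  assumes "\<And>k. 1 + A $ 2 - p + of_nat k \<noteq> 0" "\<And>k. 1 + A $ 2 + p + of_nat k \<noteq> 0"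
  shows "conv_radius (gauge A p) \<ge> 1"
proof -
  have one: "(1 :: complex) + of_nat k \<noteq> 0" for k
    using of_nat_neq_0[of k] by simp
  \<comment> \<open>The symbol (1)_n is inserted above and below to write the gauge as a product of
    two quotients of the shape covered by \<open>conv_radius_pochhammer_ratio\<close>.\<close>
  have "conv_radius (\<lambda>n. pochhammer (1 / 2 + A $ 2) n * pochhammer (1 + A $ 2 - p) n /
        (pochhammer (1 + A $ 2) n * pochhammer (1 + A $ 2 - A $ 3) n)
      * (pochhammer (1 + A $ 2 + p) n * pochhammer 1 n / (pochhammer (1 + A $ 2 + A $ 3) n * pochhammer 1 n))) \<ge> 1"
    using conv_radius_pochhammer_ratio[OF nonzero_nat(4) assms(1) nonzero_nat(3,6)]
      conv_radius_pochhammer_ratio[OF assms(2) one nonzero_nat(5) one]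
    by (intro conv_radius_hadamard) simp_all
  also have "(\<lambda>n. pochhammer (1 / 2 + A $ 2) n * pochhammer (1 + A $ 2 - p) n /
        (pochhammer (1 + A $ 2) n * pochhammer (1 + A $ 2 - A $ 3) n)
      * (pochhammer (1 + A $ 2 + p) n * pochhammer 1 n / (pochhammer (1 + A $ 2 + A $ 3) n * pochhammer 1 n))) = gauge A p"
    using pochhammer_neq_0[OF one] by (simp add: gauge_def fun_eq_iff)
  finally show ?thesis .
qed

end

text \<open>\<open>perm\<close> says, as an identity of polynomials in x^2, that p^2, (w + z)^2, (w
  - z)^2 are 0, A_0^2, A_3^2 in some order. It identifies the lowest coefficient, while
  \<open>perm'\<close> identifies the middle one.\<close>

lemma gauge_conv_solution:
  assumes indep: "int_independent A"
    and a_def: "(1 + A $ 2 + p - A $ 1) / 2 + w = a" and b_def: "(1 + A $ 2 + p - A $ 1) / 2 - w = b"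
    and c_def: "(1 + A $ 2 - p + A $ 1) / 2 + z = c" and d_def: "(1 + A $ 2 - p + A $ 1) / 2 - z = d"
    and abcd: "\<And>k. a + of_nat k \<noteq> 0" "\<And>k. b + of_nat k \<noteq> 0" "\<And>k. c + of_nat k \<noteq> 0" "\<And>k. d + of_nat k \<noteq> 0"
    and p: "\<And>k. 1 + A $ 2 + p + of_nat k \<noteq> 0" "\<And>k. 1 + A $ 2 - p + of_nat k \<noteq> 0"
    and perm: "\<And>x. (x\<^sup>2 - p\<^sup>2) * ((x\<^sup>2 - (w + z)\<^sup>2) * (x\<^sup>2 - (w - z)\<^sup>2)) = x\<^sup>2 * (x\<^sup>2 - (A $ 0)\<^sup>2) * (x\<^sup>2 - (A $ 3)\<^sup>2)"
    and perm': "p\<^sup>2 + (w + z)\<^sup>2 + (w - z)\<^sup>2 = (A $ 0)\<^sup>2 + (A $ 3)\<^sup>2"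
    and C: "\<And>n. C n = gauge A p n * (\<Sum>i\<le>n. hyp_coeff a b (1 + A $ 2 + p) i * hyp_coeff c d (1 + A $ 2 - p) (n - i))"
  shows "frob_rec A C" "conv_radius C \<ge> 1"
proof -
  define S where "S n = (\<Sum>i\<le>n. hyp_coeff a b (1 + A $ 2 + p) i * hyp_coeff c d (1 + A $ 2 - p) (n - i))" for n
  have C: "C n = gauge A p n * S n" for n
    by (simp add: C S_def)
  have "conv_radius S \<ge> 1"
    using conv_radius_mult_ge[of "hyp_coeff a b (1 + A $ 2 + p)" "hyp_coeff c d (1 + A $ 2 - p)"]
      conv_radius_hyp_coeff[OF abcd(1,2) p(1)] conv_radius_hyp_coeff[OF abcd(3,4) p(2)]
    by (simp add: S_def[abs_def])
  then have "conv_radius (\<lambda>n. gauge A p n * S n) \<ge> 1"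
    by (rule conv_radius_hadamard[OF conv_radius_gauge[OF indep p(2,1)]])
  moreover have "C = (\<lambda>n. gauge A p n * S n)"
    by (rule ext) (rule C)
  ultimately show "conv_radius C \<ge> 1"
    by (simp only:)
  \<comment> \<open>Chosen so that 2u + 1 and 2v + 1 are the lower parameters and u + v = A_2; the N
    of \<open>conv_rec\<close> is then n + 1 + A_2.\<close>
  define u v where "u = (A $ 2 + p) / 2" and "v = (A $ 2 - p) / 2"
  have uv: "u + v = A $ 2" "u - v = p" "2 * u + 1 = 1 + A $ 2 + p" "2 * v + 1 = 1 + A $ 2 - p"
    by (simp_all add: u_def v_def field_simps)
  have abcd_eq: "a = u + (1 - A $ 1) / 2 + w" "b = u + (1 - A $ 1) / 2 - w"
    "c = v + (1 + A $ 1) / 2 + z" "d = v + (1 + A $ 1) / 2 - z"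
    unfolding a_def[symmetric] b_def[symmetric] c_def[symmetric] d_def[symmetric]
    by (simp_all add: u_def v_def field_simps)
  \<comment> \<open>Since 0 is among the three values, \<open>perm\<close> at x = 0 forces p = 0 or
    w^2 = z^2, that is u^2 = v^2 or w^2 = z^2.\<close>
  have "p\<^sup>2 * (w\<^sup>2 - z\<^sup>2)\<^sup>2 = 0"
    using perm[of 0] by (simp add: power2_eq_square algebra_simps)
  then have degen: "(u\<^sup>2 - v\<^sup>2) * (w\<^sup>2 - z\<^sup>2) = 0"
    using uv(2) by (auto simp: power2_eq_square square_diff_square_factored)
  have \<kappa>: "2 * (u\<^sup>2 + v\<^sup>2 + w\<^sup>2 + z\<^sup>2) - (A $ 1)\<^sup>2 - 1 / 2 = (A $ 0)\<^sup>2 - (A $ 1)\<^sup>2 + (A $ 2)\<^sup>2 + (A $ 3)\<^sup>2 - 1 / 2"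
    using perm' uv(1,2) by algebra
  have res_Suc: "frob_res A C (Suc n) = 0" for n
  proof -
    define N where "N = of_nat n + 1 + A $ 2"
    define X where "X = (case n of 0 \<Rightarrow> 0
       | Suc m \<Rightarrow> N * (((N - 1)\<^sup>2 - (w + z)\<^sup>2) * ((N - 1)\<^sup>2 - (w - z)\<^sup>2)) * S m)"
    define Y where "Y = (case n of 0 \<Rightarrow> 0 | Suc m \<Rightarrow> low A (N - 1) * C m)"
    have N_eq: "N = of_nat n + 1 + u + v"
      using uv(1) by (simp add: N_def add.assoc)
    have S: "(N - 1) * ((N\<^sup>2 - (A $ 2)\<^sup>2) * (N\<^sup>2 - p\<^sup>2)) * S (Suc n)
        + N * (N - 1) * (N - 1 / 2) * ((A $ 0)\<^sup>2 - (A $ 1)\<^sup>2 + (A $ 2)\<^sup>2 + (A $ 3)\<^sup>2 - 1 / 2 - 2 * (N - 1 / 2)\<^sup>2) * S n + X = 0"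
      using conv_rec[OF degen _ _ N_eq refl, of "A $ 1", folded abcd_eq] p
      unfolding uv \<kappa> X_def S_def by blast
    have nz: "N \<noteq> 0" "N - 1 \<noteq> 0"
      using nonzero_nat(1,2)[OF indep, of n] by (simp_all add: N_def add_ac)
    \<comment> \<open>Multiplying by (N - 1)((N - 1)^2 - A_3^2), which is nonzero, allows the gauge
      relation one level lower to be inserted; \<open>perm\<close> at N - 1 then produces
      \<open>low\<close>.\<close>
    have Y: "N * (N - 1) * Y = (N - 1 / 2) * gauge A p n * X"
    proof (cases n)
      case (Suc m)
      have N1: "of_nat m + 1 + A $ 2 = N - 1"
        by (simp add: N_def Suc)
      have "N - 1 + A $ 3 \<noteq> 0" "N - 1 - A $ 3 \<noteq> 0"
      proof -
        have eq: "1 + A $ 2 + A $ 3 + of_nat m = N - 1 + A $ 3" "1 + A $ 2 - A $ 3 + of_nat m = N - 1 - A $ 3"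
          by (simp_all add: N_def Suc)
        show "N - 1 + A $ 3 \<noteq> 0"
          using nonzero_nat(5)[OF indep, of m] unfolding eq .
        show "N - 1 - A $ 3 \<noteq> 0"
          using nonzero_nat(6)[OF indep, of m] unfolding eq .
      qed
      then have nz3: "(N - 1)\<^sup>2 - (A $ 3)\<^sup>2 \<noteq> 0"
        unfolding power2_eq_square square_diff_square_factored by (rule no_zero_divisors)
      have "(N - 1) * ((N - 1)\<^sup>2 - (A $ 3)\<^sup>2) * gauge A p n = (N - 1 - 1 / 2) * ((N - 1)\<^sup>2 - p\<^sup>2) * gauge A p m"
        using gauge_Suc[OF indep, of m p] unfolding N1 Suc .
      moreover note perm[of "N - 1"]
      ultimately have "(N - 1) * ((N - 1)\<^sup>2 - (A $ 3)\<^sup>2) * (N * (N - 1) * Y) =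
          (N - 1) * ((N - 1)\<^sup>2 - (A $ 3)\<^sup>2) * ((N - 1 / 2) * gauge A p n * X)"
        unfolding X_def Y_def Suc nat.case low_def C by algebra
      then show ?thesis
        using nz nz3 by simp
    qed (simp add: X_def Y_def)
    have "frob_res A C (Suc n) = (N\<^sup>2 - (A $ 2)\<^sup>2) * (N\<^sup>2 - (A $ 3)\<^sup>2) * (gauge A p (Suc n) * S (Suc n))
      + (N - 1 / 2)\<^sup>2 * ((A $ 0)\<^sup>2 - (A $ 1)\<^sup>2 + (A $ 2)\<^sup>2 + (A $ 3)\<^sup>2 - 1 / 2 - 2 * (N - 1 / 2)\<^sup>2) * (gauge A p n * S n) + Y"
    proof -
      have "of_nat (Suc n) + A $ 2 = N" "of_nat (Suc n) - 1 / 2 + A $ 2 = N - 1 / 2" "of_nat (Suc n) - 1 + A $ 2 = N - 1"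
        by (simp_all add: N_def)
      then show ?thesis
        unfolding frob_res_def Y_def by (simp only: lead_def mid_def C) (cases n; simp)
    qed
    also have "\<dots> = 0"
      using gauge_step[OF S gauge_Suc[OF indep, of n p, folded N_def] Y nz] .
    finally show ?thesis .
  qed
  have "frob_res A C 0 = 0"
    by (simp add: frob_res_def lead_def)
  then have "frob_res A C n = 0" for n
    using res_Suc by (cases n) (simp_all only:)
  moreover have "C 0 = 1"
    by (simp add: C S_def gauge_def)
  ultimately show "frob_rec A C"
    unfolding frob_rec_def by (simp only: simp_thms)
qed

context
  fixes A :: "complex ^ 4"
  assumes indep: "int_independent A"
begin

lemmas nonzero_simps = nonzero_nat[OF indep] nonzero_Aeps_nat[OF indep]

text \<open>Here p = 0, so both lower parameters equal 1 + A_2 and degeneracy comes from u = v. The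
  values w = (a - b)/2 and z = (c - d)/2 give w + z = A_3 and w - z = A_0.\<close>

lemma coeff_I_solution: "frob_rec A (coeff_I A)" "conv_radius (coeff_I A) \<ge> 1"
proof -
  let ?a = "Aeps A 1 (-1) 1 1" and ?b = "Aeps A (-1) (-1) 1 (-1)"
    and ?c = "Aeps A (-1) 1 1 1" and ?d = "Aeps A 1 1 1 (-1)"
  define w z where "w = (A $ 0 + A $ 3) / 2" and "z = (A $ 3 - A $ 0) / 2"
  have abcd: "(1 + A $ 2 + 0 - A $ 1) / 2 + w = ?a" "(1 + A $ 2 + 0 - A $ 1) / 2 - w = ?b"
    "(1 + A $ 2 - 0 + A $ 1) / 2 + z = ?c" "(1 + A $ 2 - 0 + A $ 1) / 2 - z = ?d"
    by (simp_all add: w_def z_def Aeps_def field_simps)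
  have wz: "w + z = A $ 3" "w - z = A $ 0"
    by (simp_all add: w_def z_def field_simps)
  have reflect: "- A $ 2 - of_nat n = 1 - (1 + A $ 2) - of_nat n" "Aeps A (-1) 1 (-1) (-1) = 1 - ?a" "Aeps A 1 1 (-1) 1 = 1 - ?b" for n
    by (simp_all add: Aeps_def field_simps)
  have "coeff_I A n = gauge A 0 n * (\<Sum>i\<le>n. hyp_coeff ?a ?b (1 + A $ 2 + 0) i * hyp_coeff ?c ?d (1 + A $ 2 - 0) (n - i))" for n
  proof -
    have "coeff_I A n = pochhammer (1 / 2 + A $ 2) n / (pochhammer (1 + A $ 2 - A $ 3) n * pochhammer (1 + A $ 2 + A $ 3) n)
      * (pochhammer ?a n * pochhammer ?b n / fact n * hypergeom [- of_nat n, 1 - (1 + A $ 2) - of_nat n, ?c, ?d]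
         [1 - ?a - of_nat n, 1 - ?b - of_nat n, 1 + A $ 2] 1)"
      unfolding coeff_I_def reflect by (simp add: mult_ac)
    also have "pochhammer ?a n * pochhammer ?b n / fact n * hypergeom [- of_nat n, 1 - (1 + A $ 2) - of_nat n, ?c, ?d]
         [1 - ?a - of_nat n, 1 - ?b - of_nat n, 1 + A $ 2] 1 =
       pochhammer (1 + A $ 2) n * (\<Sum>i\<le>n. hyp_coeff ?a ?b (1 + A $ 2) i * hyp_coeff ?c ?d (1 + A $ 2) (n - i))"
      by (intro hypergeom_4F3_conv nonzero_simps) simp_all
    finally show ?thesis
      using pochhammer_neq_0[OF nonzero_simps(3), of n] by (simp add: gauge_def)
  qed
  note C = this
  have nz: "?a + of_nat k \<noteq> 0" "?b + of_nat k \<noteq> 0" "?c + of_nat k \<noteq> 0" "?d + of_nat k \<noteq> 0"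
      "1 + A $ 2 + 0 + of_nat k \<noteq> 0" "1 + A $ 2 - 0 + of_nat k \<noteq> 0" for k
    by (simp_all add: nonzero_Aeps_nat[OF indep] nonzero_nat[OF indep])
  have perm: "(x\<^sup>2 - 0\<^sup>2) * ((x\<^sup>2 - (w + z)\<^sup>2) * (x\<^sup>2 - (w - z)\<^sup>2)) = x\<^sup>2 * (x\<^sup>2 - (A $ 0)\<^sup>2) * (x\<^sup>2 - (A $ 3)\<^sup>2)" for x
    unfolding wz zero_power2 by algebra
  have perm': "0\<^sup>2 + (w + z)\<^sup>2 + (w - z)\<^sup>2 = (A $ 0)\<^sup>2 + (A $ 3)\<^sup>2"
    unfolding wz zero_power2 by algebra
  note sol = gauge_conv_solution[OF indep abcd nz perm perm' C]
  show "frob_rec A (coeff_I A)" "conv_radius (coeff_I A) \<ge> 1"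
    by (fact sol)+
qed

text \<open>Here p = A_0 and degeneracy comes from w = z = A_3/2. The symbol (1 + A_2 + A_0)_n,
  absent from the prefactor, is supplied by \<open>hypergeom_4F3_conv\<close>.\<close>

lemma coeff_II_solution: "frob_rec A (coeff_II A)" "conv_radius (coeff_II A) \<ge> 1"
proof -
  let ?a = "Aeps A 1 (-1) 1 1" and ?b = "Aeps A 1 (-1) 1 (-1)"
    and ?c = "Aeps A (-1) 1 1 1" and ?d = "Aeps A (-1) 1 1 (-1)"
  define w where "w = A $ 3 / 2"
  have abcd: "(1 + A $ 2 + A $ 0 - A $ 1) / 2 + w = ?a" "(1 + A $ 2 + A $ 0 - A $ 1) / 2 - w = ?b"
    "(1 + A $ 2 - A $ 0 + A $ 1) / 2 + w = ?c" "(1 + A $ 2 - A $ 0 + A $ 1) / 2 - w = ?d"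
    by (simp_all add: w_def Aeps_def field_simps)
  have wz: "w + w = A $ 3" "w - w = 0"
    by (simp_all add: w_def)
  have reflect: "- A $ 0 - A $ 2 - of_nat n = 1 - (1 + A $ 2 + A $ 0) - of_nat n"
      "Aeps A (-1) 1 (-1) (-1) = 1 - ?a" "Aeps A (-1) 1 (-1) 1 = 1 - ?b"
      "1 - A $ 0 + A $ 2 = 1 + A $ 2 - A $ 0" for n
    by (simp_all add: Aeps_def field_simps)
  have "coeff_II A n = gauge A (A $ 0) n * (\<Sum>i\<le>n. hyp_coeff ?a ?b (1 + A $ 2 + A $ 0) i * hyp_coeff ?c ?d (1 + A $ 2 - A $ 0) (n - i))" for n
  proof -
    have "coeff_II A n = pochhammer (1 / 2 + A $ 2) n * pochhammer (1 + A $ 2 - A $ 0) n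
      / (pochhammer (1 + A $ 2) n * pochhammer (1 + A $ 2 - A $ 3) n * pochhammer (1 + A $ 2 + A $ 3) n)
      * (pochhammer ?a n * pochhammer ?b n / fact n * hypergeom [- of_nat n, 1 - (1 + A $ 2 + A $ 0) - of_nat n, ?c, ?d]
         [1 - ?a - of_nat n, 1 - ?b - of_nat n, 1 + A $ 2 - A $ 0] 1)"
      unfolding coeff_II_def reflect by (simp add: mult_ac)
    also have "pochhammer ?a n * pochhammer ?b n / fact n * hypergeom [- of_nat n, 1 - (1 + A $ 2 + A $ 0) - of_nat n, ?c, ?d]
         [1 - ?a - of_nat n, 1 - ?b - of_nat n, 1 + A $ 2 - A $ 0] 1 =
       pochhammer (1 + A $ 2 + A $ 0) n *
         (\<Sum>i\<le>n. hyp_coeff ?a ?b (1 + A $ 2 + A $ 0) i * hyp_coeff ?c ?d (1 + A $ 2 - A $ 0) (n - i))"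
      by (intro hypergeom_4F3_conv nonzero_simps) simp_all
    finally show ?thesis
      by (simp add: gauge_def)
  qed
  note C = this
  have nz: "?a + of_nat k \<noteq> 0" "?b + of_nat k \<noteq> 0" "?c + of_nat k \<noteq> 0" "?d + of_nat k \<noteq> 0"
      "1 + A $ 2 + A $ 0 + of_nat k \<noteq> 0" "1 + A $ 2 - A $ 0 + of_nat k \<noteq> 0" for k
    by (simp_all add: nonzero_Aeps_nat[OF indep] nonzero_nat[OF indep])
  have perm: "(x\<^sup>2 - (A $ 0)\<^sup>2) * ((x\<^sup>2 - (w + w)\<^sup>2) * (x\<^sup>2 - (w - w)\<^sup>2)) = x\<^sup>2 * (x\<^sup>2 - (A $ 0)\<^sup>2) * (x\<^sup>2 - (A $ 3)\<^sup>2)" for x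
    unfolding wz zero_power2 by algebra
  have perm': "(A $ 0)\<^sup>2 + (w + w)\<^sup>2 + (w - w)\<^sup>2 = (A $ 0)\<^sup>2 + (A $ 3)\<^sup>2"
    unfolding wz zero_power2 by algebra
  note sol = gauge_conv_solution[OF indep abcd nz perm perm' C]
  show "frob_rec A (coeff_II A)" "conv_radius (coeff_II A) \<ge> 1"
    by (fact sol)+
qed

text \<open>Here p = A_3 and w = z = A_0/2; the symbols with 1 + A_2 + A_3 and 1 + A_2 - A_3 cancel
  inside the gauge.\<close>

lemma coeff_III_solution: "frob_rec A (coeff_III A)" "conv_radius (coeff_III A) \<ge> 1"
proof -
  let ?a = "Aeps A 1 (-1) 1 1" and ?b = "Aeps A (-1) (-1) 1 1"
    and ?c = "Aeps A 1 1 1 (-1)" and ?d = "Aeps A (-1) 1 1 (-1)"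
  define w where "w = A $ 0 / 2"
  have abcd: "(1 + A $ 2 + A $ 3 - A $ 1) / 2 + w = ?a" "(1 + A $ 2 + A $ 3 - A $ 1) / 2 - w = ?b"
    "(1 + A $ 2 - A $ 3 + A $ 1) / 2 + w = ?c" "(1 + A $ 2 - A $ 3 + A $ 1) / 2 - w = ?d"
    by (simp_all add: w_def Aeps_def field_simps)
  have wz: "w + w = A $ 0" "w - w = 0"
    by (simp_all add: w_def)
  have reflect: "- A $ 2 - A $ 3 - of_nat n = 1 - (1 + A $ 2 + A $ 3) - of_nat n"
      "Aeps A (-1) 1 (-1) (-1) = 1 - ?a" "Aeps A 1 1 (-1) (-1) = 1 - ?b" for n
    by (simp_all add: Aeps_def field_simps)
  have "coeff_III A n = gauge A (A $ 3) n * (\<Sum>i\<le>n. hyp_coeff ?a ?b (1 + A $ 2 + A $ 3) i * hyp_coeff ?c ?d (1 + A $ 2 - A $ 3) (n - i))" for n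
  proof -
    have "coeff_III A n = pochhammer (1 / 2 + A $ 2) n
      / (pochhammer (1 + A $ 2) n * pochhammer (1 + A $ 2 + A $ 3) n)
      * (pochhammer ?a n * pochhammer ?b n / fact n * hypergeom [- of_nat n, 1 - (1 + A $ 2 + A $ 3) - of_nat n, ?c, ?d]
         [1 - ?a - of_nat n, 1 - ?b - of_nat n, 1 + A $ 2 - A $ 3] 1)"
      unfolding coeff_III_def reflect by (simp add: mult_ac)
    also have "pochhammer ?a n * pochhammer ?b n / fact n * hypergeom [- of_nat n, 1 - (1 + A $ 2 + A $ 3) - of_nat n, ?c, ?d]
         [1 - ?a - of_nat n, 1 - ?b - of_nat n, 1 + A $ 2 - A $ 3] 1 =
       pochhammer (1 + A $ 2 + A $ 3) n *
         (\<Sum>i\<le>n. hyp_coeff ?a ?b (1 + A $ 2 + A $ 3) i * hyp_coeff ?c ?d (1 + A $ 2 - A $ 3) (n - i))"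
      by (intro hypergeom_4F3_conv nonzero_simps) simp_all
    finally show ?thesis
      using pochhammer_neq_0[OF nonzero_simps(5), of n] pochhammer_neq_0[OF nonzero_simps(6), of n]
      by (simp add: gauge_def)
  qed
  note C = this
  have nz: "?a + of_nat k \<noteq> 0" "?b + of_nat k \<noteq> 0" "?c + of_nat k \<noteq> 0" "?d + of_nat k \<noteq> 0"
      "1 + A $ 2 + A $ 3 + of_nat k \<noteq> 0" "1 + A $ 2 - A $ 3 + of_nat k \<noteq> 0" for k
    by (simp_all add: nonzero_Aeps_nat[OF indep] nonzero_nat[OF indep])
  have perm: "(x\<^sup>2 - (A $ 3)\<^sup>2) * ((x\<^sup>2 - (w + w)\<^sup>2) * (x\<^sup>2 - (w - w)\<^sup>2)) = x\<^sup>2 * (x\<^sup>2 - (A $ 0)\<^sup>2) * (x\<^sup>2 - (A $ 3)\<^sup>2)" for x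
    unfolding wz zero_power2 by algebra
  have perm': "(A $ 3)\<^sup>2 + (w + w)\<^sup>2 + (w - w)\<^sup>2 = (A $ 0)\<^sup>2 + (A $ 3)\<^sup>2"
    unfolding wz zero_power2 by algebra
  note sol = gauge_conv_solution[OF indep abcd nz perm perm' C]
  show "frob_rec A (coeff_III A)" "conv_radius (coeff_III A) \<ge> 1"
    by (fact sol)+
qed

end

section \<open>Identification of the normalized solution, sign changes, and the theorem\<close>

lemma f_inf_A2_eq:
  assumes "int_independent A" "frob_rec A C" "conv_radius C \<ge> 1"
  shows "\<exists>!C. normalized_solution_inf A (rho_A2 A) C"
    and "f_inf_A2 A = frobenius_inf (rho_A2 A) C"
  using normalized_iff[OF assms] by (simp_all add: f_inf_A2_def)

lemma sign_change_nth:
  "sign_change s0 s1 s3 A $ 0 = s0 * A $ 0" "sign_change s0 s1 s3 A $ 1 = s1 * A $ 1"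
  "sign_change s0 s1 s3 A $ 2 = A $ 2" "sign_change s0 s1 s3 A $ 3 = s3 * A $ 3"
  by (simp_all add: sign_change_def)

lemma sign_change_frob_rec:
  assumes "s0 \<in> {1, -1}" "s1 \<in> {1, -1}" "s3 \<in> {1, -1}"
  shows "frob_rec (sign_change s0 s1 s3 A) = frob_rec A"
proof -
  have "(s * x)\<^sup>2 = x\<^sup>2" if "s \<in> {1, -1}" for s x :: complex
    using that by auto
  with assms show ?thesis
    by (simp add: frob_rec_def frob_res_def lead_def mid_def low_def sign_change_nth fun_eq_iff)
qed

lemma sign_change_int_independent:
  assumes "int_independent A" "s0 \<in> {1, -1}" "s1 \<in> {1, -1}" "s3 \<in> {1, -1}"
  shows "int_independent (sign_change s0 s1 s3 A)"
proof -
  have int: "\<exists>t :: int. s = of_int t \<and> t \<noteq> 0" if "s \<in> {1, -1}" for s :: complex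
    using that by (auto intro: exI[of _ 1] exI[of _ "-1"])
  obtain t0 t1 t3 :: int where t: "s0 = of_int t0" "s1 = of_int t1" "s3 = of_int t3" "t0 \<noteq> 0" "t1 \<noteq> 0" "t3 \<noteq> 0"
    using int assms(2-4) by metis
  show ?thesis
    unfolding int_independent_def sign_change_nth
  proof (intro allI impI)
    fix c0 c1 c2 c3 m :: int
    assume "of_int c0 * (s0 * A $ 0) + of_int c1 * (s1 * A $ 1) + of_int c2 * A $ 2 + of_int c3 * (s3 * A $ 3) = of_int m"
    then have "of_int (c0 * t0) * A $ 0 + of_int (c1 * t1) * A $ 1 + of_int c2 * A $ 2 + of_int (c3 * t3) * A $ 3 = of_int m"
      by (simp add: t mult.assoc)
    then have "c0 * t0 = 0 \<and> c1 * t1 = 0 \<and> c2 = 0 \<and> c3 * t3 = 0"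
      using assms(1) unfolding int_independent_def by blast
    then show "c0 = 0 \<and> c1 = 0 \<and> c2 = 0 \<and> c3 = 0"
      using t by simp
  qed
qed

text \<open>Off the slit Ln(1/x) = -Ln x, so the two principal powers cancel and only the power
  series in 1/x remains.\<close>

lemma powr_frobenius_inf:
  assumes "x \<notin> \<real>\<^sub>\<le>\<^sub>0"
  shows "x powr \<rho> * frobenius_inf \<rho> C x = (\<Sum>n. C n * (1 / x) ^ n)"
proof -
  have "x powr \<rho> * (1 / x) powr \<rho> = 1"
    using assms Ln_inverse[OF assms] by (auto simp: powr_def divide_inverse simp flip: exp_add)
  then show ?thesis
    by (simp add: frobenius_inf_def mult.assoc[symmetric])
qed

theorem theorem10p20:
  shows "for_generic (\<lambda>A :: complex ^ 4.
    (\<exists>!C. normalized_solution_inf A (rho_A2 A) C) \<and>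
    (\<forall>c \<in> {coeff_I A, coeff_II A, coeff_III A}. \<forall>x. norm x > 1 \<and> x \<notin> \<real>\<^sub>\<le>\<^sub>0 \<longrightarrow>
       summable (\<lambda>n. (1 / x) ^ n * c n) \<and>
       f_inf_A2 A x = (1 / x) powr (1 - A $ 0 + A $ 2) * (\<Sum>n. (1 / x) ^ n * c n)) \<and>
    (\<forall>s0 \<in> {1, -1}. \<forall>s1 \<in> {1, -1}. \<forall>s3 \<in> {1, -1}. let B = sign_change s0 s1 s3 A in
       (\<exists>!C. normalized_solution_inf B (rho_A2 B) C) \<and>
       (\<forall>x. norm x > 1 \<and> x \<notin> \<real>\<^sub>\<le>\<^sub>0 \<longrightarrow>
          x powr (1 - B $ 0 + B $ 2) * f_inf_A2 B x = x powr (1 - A $ 0 + A $ 2) * f_inf_A2 A x)))"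
proof (rule for_generic_mono[OF for_generic_int_independent], intro conjI ballI allI impI)
  fix A :: "complex ^ 4"
  assume A: "int_independent A"
  note sol_I = coeff_I_solution[OF A]
  show "\<exists>!C. normalized_solution_inf A (rho_A2 A) C"
    by (rule f_inf_A2_eq(1)[OF A sol_I])
  fix x :: complex
  {
    fix c assume "c \<in> {coeff_I A, coeff_II A, coeff_III A}"
    then have c: "frob_rec A c" "conv_radius c \<ge> 1"
      using sol_I coeff_II_solution[OF A] coeff_III_solution[OF A] by auto
    assume x: "norm x > 1 \<and> x \<notin> \<real>\<^sub>\<le>\<^sub>0"
    then have "ereal (norm (1 / x)) < 1"
      by (simp add: norm_divide divide_less_eq)
    then have "norm (1 / x) < conv_radius c"
      using c(2) by (rule less_le_trans)
    then have "summable (\<lambda>n. c n * (1 / x) ^ n)"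
      by (rule summable_in_conv_radius)
    then show "summable (\<lambda>n. (1 / x) ^ n * c n)"
      by (simp only: mult.commute)
    show "f_inf_A2 A x = (1 / x) powr (1 - A $ 0 + A $ 2) * (\<Sum>n. (1 / x) ^ n * c n)"
      unfolding f_inf_A2_eq(2)[OF A c] frobenius_inf_def rho_A2_def by (simp only: mult.commute[of "c _"])
  }
next
  fix A :: "complex ^ 4" and s0 s1 s3 :: complex
  assume A: "int_independent A" and s: "s0 \<in> {1, -1}" "s1 \<in> {1, -1}" "s3 \<in> {1, -1}"
  note sol = coeff_I_solution[OF A]
  define B where "B = sign_change s0 s1 s3 A"
  \<comment> \<open>The coefficients for A solve the recurrence for B too, so by uniqueness they are
    the normalized coefficients for B; only the exponent in the prefactor differs.\<close>
  have B: "int_independent B" "frob_rec B (coeff_I A)"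
    using sign_change_int_independent[OF A s] sign_change_frob_rec[OF s] sol(1) by (simp_all add: B_def)
  have "x powr (1 - B $ 0 + B $ 2) * f_inf_A2 B x = x powr (1 - A $ 0 + A $ 2) * f_inf_A2 A x"
    if "x \<notin> \<real>\<^sub>\<le>\<^sub>0" for x
    unfolding f_inf_A2_eq(2)[OF A sol] f_inf_A2_eq(2)[OF B sol(2)] rho_A2_def[symmetric]
    by (simp only: powr_frobenius_inf[OF that])
  then show "let B = sign_change s0 s1 s3 A in
       (\<exists>!C. normalized_solution_inf B (rho_A2 B) C) \<and>
       (\<forall>x. norm x > 1 \<and> x \<notin> \<real>\<^sub>\<le>\<^sub>0 \<longrightarrow>
          x powr (1 - B $ 0 + B $ 2) * f_inf_A2 B x = x powr (1 - A $ 0 + A $ 2) * f_inf_A2 A x)"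
    using f_inf_A2_eq(1)[OF B sol(2)] unfolding Let_def B_def[symmetric] by blast
qed

end
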